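(* Let $[a,b]\subset\mathbb{R}$ be a bounded interval, let $T:\mathcal{L}^2[a,b]\to\mathcal{L}^2[a,b]$ be a bounded injective linear operator with adjoint $T^*$, let $\varphi\in\mathcal{L}^2[a,b]$ and $g=T\varphi$. For $\psi\in\mathcal{L}^2[a,b]$ put $u:=-\Delta^{-1}g$, $u_\psi:=-\Delta^{-1}(T\psi)$, and $$G(\psi):=\|T\psi-g\|_{\mathcal{L}^2}^2+\|u'-u_\psi'\|_{\mathcal{L}^2}^2 .$$ Then: 1. For any $\psi_1,\psi_2\in\mathcal{L}^2[a,b]$, $$G(\psi_1)-G(\psi_2)=\int_a^b -2\,T(\psi_1-\psi_2)\left[\Big(g-\frac{T\psi_1+T\psi_2}{2}\Big)+\Big(u-\frac{u_{\psi_1}+u_{\psi_2}}{2}\Big)\right]dx .$$ 2. The first Gâteaux differential of $G$ at $\psi\in\mathcal{L}^2[a,b]$ is $$G'(\psi)[h]=\int_a^b (Th)\Big(-2\big((g-T\psi)+(u-u_\psi)\big)\Big)\,dx,\qquad h\in\mathcal{L}^2[a,b],$$ and the $\mathcal{L}^2$-gradient of $G$ at $\psi$ is $\nabla_{\mathcal{L}^2}^{\psi}G=-2T^*\big((g-T\psi)+(u-u_\psi)\big)$. 3. The second Gâteaux differential of $G$ at any $\psi\in\mathcal{L}^2[a,b]$ is $$G''(\psi)[h,k]=2\big(Th-\Delta^{-1}(Th),\,Tk\big)_{\mathcal{L}^2},\qquad h,k\in\mathcal{L}^2[a,b].$$ Hence for any $\psi\in\mathcal{L}^2[a,b]$, $G''(\psi)$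 is a positive definite quadratic form.
   Context: All functions are real-valued on $[a,b]$; $(\cdot,\cdot)_{\mathcal{L}^2}$ and $\|\cdot\|_{\mathcal{L}^2}$ are the usual inner product and norm of $\mathcal{L}^2[a,b]$. For $f\in\mathcal{L}^2[a,b]$, $y=-\Delta^{-1}f$ denotes the unique solution $y\in\mathcal{H}^2_0[a,b]$ of $-y''=f$, $y(a)=0$, $y(b)=0$; here $\mathcal{H}^2_0[a,b]$ is the set of functions in the Sobolev space $\mathcal{H}^2[a,b]$ that vanish at $a$ and $b$. The first Gâteaux differential of a functional $G$ at $\psi$ in direction $h$ is $G'(\psi)[h]=\lim_{\epsilon\to0}\epsilon^{-1}(G(\psi+\epsilon h)-G(\psi))$, and the second is $G''(\psi)[h,k]=\lim_{\epsilon\to0}\epsilon^{-1}(G'(\psi+\epsilon h)[k]-G'(\psi)[k])$. The $\mathcal{L}^2$-gradient at $\psi$ is the element $\nabla_{\mathcal{L}^2}^{\psi}G\in\mathcal{L}^2[a,b]$ with $G'(\psi)[h]=(h,\nabla_{\mathcal{L}^2}^{\psi}G)_{\mathcal{L}^2}$ for all $h\in\mathcal{L}^2[a,b]$. *)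

theory Defs
  imports "HOL-Analysis.Analysis"
begin

text \<open>
  The space \<open>L\<^sup>2[a,b]\<close> is handled through representatives: its elements are functions on the reals,
  of which only the restriction to \<open>[a,b]\<close> matters, and equality in \<open>L\<^sup>2[a,b]\<close> is \<open>L2_eq\<close>.
\<close>

definition L2_space :: "real \<Rightarrow> real \<Rightarrow> (real \<Rightarrow> real) set" where
  "L2_space a b = {f. f \<in> borel_measurable (lebesgue_on {a..b}) \<and>
                      integrable (lebesgue_on {a..b}) (\<lambda>x. (f x)\<^sup>2)}"

definition L2_eq :: "real \<Rightarrow> real \<Rightarrow> (real \<Rightarrow> real) \<Rightarrow> (real \<Rightarrow> real) \<Rightarrow> bool" where
  "L2_eq a b f g \<longleftrightarrow> (AE x in lebesgue_on {a..b}. f x = g x)"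

definition L2_inner :: "real \<Rightarrow> real \<Rightarrow> (real \<Rightarrow> real) \<Rightarrow> (real \<Rightarrow> real) \<Rightarrow> real" where
  "L2_inner a b f g = (LINT x|lebesgue_on {a..b}. f x * g x)"

definition L2_norm :: "real \<Rightarrow> real \<Rightarrow> (real \<Rightarrow> real) \<Rightarrow> real" where
  "L2_norm a b f = sqrt (L2_inner a b f f)"

definition L2_bounded_linear ::
    "real \<Rightarrow> real \<Rightarrow> ((real \<Rightarrow> real) \<Rightarrow> (real \<Rightarrow> real)) \<Rightarrow> bool" where
  "L2_bounded_linear a b T \<longleftrightarrow>
     (\<forall>f\<in>L2_space a b. T f \<in> L2_space a b) \<and>
     (\<forall>f\<in>L2_space a b. \<forall>g\<in>L2_space a b. L2_eq a b f g \<longrightarrow> L2_eq a b (T f) (T g)) \<and>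
     (\<forall>f\<in>L2_space a b. \<forall>g\<in>L2_space a b.
        L2_eq a b (T (\<lambda>x. f x + g x)) (\<lambda>x. T f x + T g x)) \<and>
     (\<forall>c. \<forall>f\<in>L2_space a b. L2_eq a b (T (\<lambda>x. c * f x)) (\<lambda>x. c * T f x)) \<and>
     (\<exists>C. \<forall>f\<in>L2_space a b. L2_norm a b (T f) \<le> C * L2_norm a b f)"

definition L2_injective ::
    "real \<Rightarrow> real \<Rightarrow> ((real \<Rightarrow> real) \<Rightarrow> (real \<Rightarrow> real)) \<Rightarrow> bool" where
  "L2_injective a b T \<longleftrightarrow>
     (\<forall>f\<in>L2_space a b. \<forall>g\<in>L2_space a b. L2_eq a b (T f) (T g) \<longrightarrow> L2_eq a b f g)"

definition L2_adjoint ::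
    "real \<Rightarrow> real \<Rightarrow> ((real \<Rightarrow> real) \<Rightarrow> (real \<Rightarrow> real)) \<Rightarrow>
     ((real \<Rightarrow> real) \<Rightarrow> (real \<Rightarrow> real)) \<Rightarrow> bool" where
  "L2_adjoint a b T Tstar \<longleftrightarrow>
     (\<forall>f\<in>L2_space a b. Tstar f \<in> L2_space a b) \<and>
     (\<forall>f\<in>L2_space a b. \<forall>g\<in>L2_space a b. L2_inner a b (T f) g = L2_inner a b f (Tstar g))"

text \<open>Smooth functions with compact support in the open interval \<open>(a,b)\<close>.\<close>

definition test_function :: "real \<Rightarrow> real \<Rightarrow> (real \<Rightarrow> real) \<Rightarrow> bool" where
  "test_function a b \<theta> \<longleftrightarrow>
     (\<forall>n x. (deriv ^^ n) \<theta> field_differentiable (at x)) \<and>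
     (\<exists>c d. a < c \<and> d < b \<and> (\<forall>x. x \<notin> {c..d} \<longrightarrow> \<theta> x = 0))"

definition has_weak_deriv :: "real \<Rightarrow> real \<Rightarrow> (real \<Rightarrow> real) \<Rightarrow> (real \<Rightarrow> real) \<Rightarrow> bool" where
  "has_weak_deriv a b y v \<longleftrightarrow>
     y \<in> L2_space a b \<and> v \<in> L2_space a b \<and>
     (\<forall>\<theta>. test_function a b \<theta> \<longrightarrow> L2_inner a b y (deriv \<theta>) = - L2_inner a b v \<theta>)"

text \<open>The weak derivative is determined up to \<open>L2_eq\<close>.\<close>

definition weak_deriv :: "real \<Rightarrow> real \<Rightarrow> (real \<Rightarrow> real) \<Rightarrow> (real \<Rightarrow> real)" where
  "weak_deriv a b y = (SOME v. has_weak_deriv a b y v)"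

definition H2_space :: "real \<Rightarrow> real \<Rightarrow> (real \<Rightarrow> real) set" where
  "H2_space a b = {y. \<exists>v w. has_weak_deriv a b y v \<and> has_weak_deriv a b v w}"

text \<open>
  Boundary values of an \<open>H\<^sup>2\<close> function are those of its continuous representative, so
  \<open>H2_0_space\<close> consists of continuous representatives.
\<close>

definition H2_0_space :: "real \<Rightarrow> real \<Rightarrow> (real \<Rightarrow> real) set" where
  "H2_0_space a b = {y \<in> H2_space a b. continuous_on {a..b} y \<and> y a = 0 \<and> y b = 0}"

text \<open>
  \<open>neg_inv_laplacian a b f\<close> is \<open>-\<Delta>\<^sup>-\<^sup>1 f\<close>. The choice only concerns the irrelevant values
  outside \<open>[a,b]\<close>.
\<close>

definition neg_inv_laplacian :: "real \<Rightarrow> real \<Rightarrow> (real \<Rightarrow> real) \<Rightarrow> (real \<Rightarrow> real)" where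
  "neg_inv_laplacian a b f =
     (SOME y. y \<in> H2_0_space a b \<and>
              L2_eq a b (\<lambda>x. - weak_deriv a b (weak_deriv a b y) x) f)"

definition has_gateaux ::
    "((real \<Rightarrow> real) \<Rightarrow> real) \<Rightarrow> (real \<Rightarrow> real) \<Rightarrow> (real \<Rightarrow> real) \<Rightarrow> real \<Rightarrow> bool" where
  "has_gateaux G \<psi> h D \<longleftrightarrow>
     ((\<lambda>\<epsilon>. (G (\<lambda>x. \<psi> x + \<epsilon> * h x) - G \<psi>) / \<epsilon>) \<longlongrightarrow> D) (at 0)"

definition gateaux ::
    "((real \<Rightarrow> real) \<Rightarrow> real) \<Rightarrow> (real \<Rightarrow> real) \<Rightarrow> (real \<Rightarrow> real) \<Rightarrow> real" where
  "gateaux G \<psi> h = (THE D. has_gateaux G \<psi> h D)"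

text \<open>
  The first conjunct makes sure that the values \<open>gateaux G (\<psi> + \<epsilon> h) k\<close> entering the difference
  quotient are genuine limits.
\<close>

definition has_gateaux2 ::
    "((real \<Rightarrow> real) \<Rightarrow> real) \<Rightarrow> (real \<Rightarrow> real) \<Rightarrow> (real \<Rightarrow> real) \<Rightarrow> (real \<Rightarrow> real) \<Rightarrow> real \<Rightarrow> bool"
  where
  "has_gateaux2 G \<psi> h k D \<longleftrightarrow>
     (\<forall>\<^sub>F \<epsilon> in nhds 0. \<exists>D1. has_gateaux G (\<lambda>x. \<psi> x + \<epsilon> * h x) k D1) \<and>
     has_gateaux (\<lambda>\<eta>. gateaux G \<eta> k) \<psi> h D"

definition gateaux2 ::
    "((real \<Rightarrow> real) \<Rightarrow> real) \<Rightarrow> (real \<Rightarrow> real) \<Rightarrow> (real \<Rightarrow> real) \<Rightarrow> (real \<Rightarrow> real) \<Rightarrow> real" where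
  "gateaux2 G \<psi> h k = (THE D. has_gateaux2 G \<psi> h k D)"

definition has_L2_gradient ::
    "real \<Rightarrow> real \<Rightarrow> ((real \<Rightarrow> real) \<Rightarrow> real) \<Rightarrow> (real \<Rightarrow> real) \<Rightarrow> (real \<Rightarrow> real) \<Rightarrow> bool" where
  "has_L2_gradient a b G \<psi> w \<longleftrightarrow>
     w \<in> L2_space a b \<and> (\<forall>h\<in>L2_space a b. has_gateaux G \<psi> h (L2_inner a b h w))"

text \<open>
  The quadratic form \<open>h \<mapsto> B h h\<close> of a symmetric bilinear form \<open>B\<close> on \<open>L\<^sup>2[a,b]\<close>; the first
  conjunct says that \<open>B\<close> is well defined modulo equality almost everywhere.
\<close>

definition L2_pos_def_form ::
    "real \<Rightarrow> real \<Rightarrow> ((real \<Rightarrow> real) \<Rightarrow> (real \<Rightarrow> real) \<Rightarrow> real) \<Rightarrow> bool" where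
  "L2_pos_def_form a b B \<longleftrightarrow>
     (\<forall>h\<in>L2_space a b. \<forall>h'\<in>L2_space a b. \<forall>k\<in>L2_space a b.
        L2_eq a b h h' \<longrightarrow> B h k = B h' k) \<and>
     (\<forall>h\<in>L2_space a b. \<forall>k\<in>L2_space a b. B h k = B k h) \<and>
     (\<forall>h\<in>L2_space a b. \<forall>h'\<in>L2_space a b. \<forall>k\<in>L2_space a b.
        B (\<lambda>x. h x + h' x) k = B h k + B h' k) \<and>
     (\<forall>c. \<forall>h\<in>L2_space a b. \<forall>k\<in>L2_space a b. B (\<lambda>x. c * h x) k = c * B h k) \<and>
     (\<forall>h\<in>L2_space a b. \<not> L2_eq a b h (\<lambda>x. 0) \<longrightarrow> B h h > 0)"

end

theory Submission
  imports Defs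
begin

text \<open>
  Write \<open>S = I - \<Delta>\<^sup>-\<^sup>1\<close> and \<open>B r s = (S r, s)\<close>. Green's identity \<open>(-\<Delta>\<^sup>-\<^sup>1 r, s) = ((\<Delta>\<^sup>-\<^sup>1 r)', (\<Delta>\<^sup>-\<^sup>1 s)')\<close> shows that
  \<open>B\<close> is symmetric and that \<open>B r r\<close> is at least the square of the norm of \<open>r\<close>. Since \<open>-\<Delta>\<^sup>-\<^sup>1\<close> is linear,
  \<open>u\<^sub>\<psi> - u = -\<Delta>\<^sup>-\<^sup>1 r\<close> for the residual \<open>r = T \<psi> - g\<close>, and therefore \<open>G \<psi> = B r r\<close>. The functional is thus the
  quadratic form of \<open>B\<close> composed with the affine map \<open>\<psi> \<mapsto> T \<psi> - g\<close>, and all claims are algebra: the first is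
  the factorisation \<open>B r\<^sub>1 r\<^sub>1 - B r\<^sub>2 r\<^sub>2 = B (r\<^sub>1 + r\<^sub>2) (r\<^sub>1 - r\<^sub>2)\<close>, the first differential is \<open>2 B r (T h)\<close>, and the
  second is \<open>2 B (T h) (T k)\<close>, which is positive definite because \<open>T\<close> is injective.

  The work lies in the analysis behind \<open>-\<Delta>\<^sup>-\<^sup>1\<close>, which is specified through weak derivatives and a choice
  among weak solutions. Weak derivatives are unique
  (\<open>L2_eq_0_if_orthogonal_to_test_functions\<close>) and a function with weak derivative zero is constant
  (\<open>has_weak_deriv_0_imp_constant\<close>); both rest on explicit smooth bumps. Hence the Dirichlet problem has
  exactly one solution (\<open>dirichlet_solution_exists\<close>, \<open>dirichlet_solution_unique\<close>), namely the one obtained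
  by integrating twice, so \<open>-\<Delta>\<^sup>-\<^sup>1\<close> is linear up to equality almost everywhere
  (\<open>neg_inv_laplacian_lincomb\<close>). Green's identity (\<open>dirichlet_solution_green\<close>) then reduces to Fubini's
  theorem (\<open>indefinite_integral_by_parts\<close>).
\<close>

section \<open>Representatives of square integrable functions\<close>

lemma finite_measure_lebesgue_on_interval: "finite_measure (lebesgue_on {a..b::real})"
  by (intro finite_measureI) (simp add: emeasure_restrict_space emeasure_lborel_Icc_eq)

lemma L2_mult_integrable:
  assumes "f \<in> L2_space a b" "g \<in> L2_space a b"
  shows "integrable (lebesgue_on {a..b}) (\<lambda>x. f x * g x)"
proof (rule Bochner_Integration.integrable_bound)
  show "integrable (lebesgue_on {a..b}) (\<lambda>x. (f x)\<^sup>2 + (g x)\<^sup>2)"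
    and "(\<lambda>x. f x * g x) \<in> borel_measurable (lebesgue_on {a..b})"
    using assms by (auto simp: L2_space_def)
  have "\<bar>s * t\<bar> \<le> s\<^sup>2 + t\<^sup>2" for s t :: real
    using sum_squares_bound[of "\<bar>s\<bar>" "\<bar>t\<bar>"] mult_nonneg_nonneg[of "\<bar>s\<bar>" "\<bar>t\<bar>"]
    unfolding abs_mult power2_abs by linarith
  then show "AE x in lebesgue_on {a..b}. norm (f x * g x) \<le> norm ((f x)\<^sup>2 + (g x)\<^sup>2)"
    by simp
qed

lemma L2_space_lincomb:
  assumes "f \<in> L2_space a b" "g \<in> L2_space a b"
  shows "(\<lambda>x. c * f x + d * g x) \<in> L2_space a b"
proof -
  have "integrable (lebesgue_on {a..b}) (\<lambda>x. c\<^sup>2 * (f x)\<^sup>2 + 2 * c * d * (f x * g x) + d\<^sup>2 * (g x)\<^sup>2)"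
    using assms L2_mult_integrable[OF assms]
    by (intro Bochner_Integration.integrable_add integrable_mult_right) (auto simp: L2_space_def)
  moreover have "(\<lambda>x. (c * f x + d * g x)\<^sup>2)
      = (\<lambda>x. c\<^sup>2 * (f x)\<^sup>2 + 2 * c * d * (f x * g x) + d\<^sup>2 * (g x)\<^sup>2)"
    by (auto simp: power2_eq_square algebra_simps)
  ultimately show ?thesis
    using assms by (auto simp: L2_space_def)
qed

lemma L2_space_add:
  "\<lbrakk>f \<in> L2_space a b; g \<in> L2_space a b\<rbrakk> \<Longrightarrow> (\<lambda>x. f x + g x) \<in> L2_space a b"
  using L2_space_lincomb[of f a b g 1 1] by simp

lemma L2_space_diff:
  "\<lbrakk>f \<in> L2_space a b; g \<in> L2_space a b\<rbrakk> \<Longrightarrow> (\<lambda>x. f x - g x) \<in> L2_space a b"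
  using L2_space_lincomb[of f a b g 1 "-1"] by simp

lemma L2_space_scale: "f \<in> L2_space a b \<Longrightarrow> (\<lambda>x. c * f x) \<in> L2_space a b"
  using L2_space_lincomb[of f a b f c 0] by simp

lemma continuous_imp_L2_space:
  assumes "continuous_on {a..b} f"
  shows "f \<in> L2_space a b"
  using assms
  by (auto simp: L2_space_def intro!: continuous_imp_measurable_on_sets_lebesgue
      continuous_imp_integrable_real continuous_intros)

lemma L2_space_integrable:
  assumes "f \<in> L2_space a b"
  shows "integrable (lebesgue_on {a..b}) f"
proof -
  have "(\<lambda>x. 1) \<in> L2_space a b"
    by (rule continuous_imp_L2_space) simp
  from L2_mult_integrable[OF assms this] show ?thesis by simp
qed

lemma L2_inner_commute: "L2_inner a b f g = L2_inner a b g f"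
  by (simp add: L2_inner_def mult.commute)

lemma L2_inner_lincomb_left:
  assumes "f \<in> L2_space a b" "g \<in> L2_space a b" "k \<in> L2_space a b"
  shows "L2_inner a b (\<lambda>x. c * f x + d * g x) k = c * L2_inner a b f k + d * L2_inner a b g k"
  using L2_mult_integrable[OF assms(1,3)] L2_mult_integrable[OF assms(2,3)]
  by (simp add: L2_inner_def distrib_right mult.assoc)

lemma L2_inner_cong:
  assumes "f \<in> L2_space a b" "f' \<in> L2_space a b" "g \<in> L2_space a b" "g' \<in> L2_space a b"
    and "L2_eq a b f f'" "L2_eq a b g g'"
  shows "L2_inner a b f g = L2_inner a b f' g'"
  unfolding L2_inner_def
proof (rule integral_cong_AE)
  show "AE x in lebesgue_on {a..b}. f x * g x = f' x * g' x"
    using assms(5,6) unfolding L2_eq_def by eventually_elim simp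
qed (use assms in \<open>auto simp: L2_space_def\<close>)

lemma L2_eqI: "(\<And>x. x \<in> {a..b} \<Longrightarrow> f x = g x) \<Longrightarrow> L2_eq a b f g"
  by (auto simp: L2_eq_def intro!: AE_I2)

lemma L2_inner_self_pos:
  assumes "f \<in> L2_space a b" "\<not> L2_eq a b f (\<lambda>x. 0)"
  shows "0 < L2_inner a b f f"
proof -
  have "L2_inner a b f f = 0 \<longleftrightarrow> L2_eq a b f (\<lambda>x. 0)"
    using integral_nonneg_eq_0_iff_AE[OF L2_mult_integrable[OF assms(1) assms(1)]]
    by (simp add: L2_inner_def L2_eq_def)
  moreover have "L2_inner a b f f \<ge> 0"
    by (simp add: L2_inner_def)
  ultimately show ?thesis
    using assms(2) by linarith
qed

text \<open>
  A nonnegative continuous function with vanishing integral is zero, applied to \<open>\<bar>f - g\<bar>\<close>. This is what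
  gives pointwise meaning to boundary values and turns almost everywhere uniqueness into equality.
\<close>

lemma continuous_L2_eq_imp_eq:
  assumes "a < b" "continuous_on {a..b} f" "continuous_on {a..b} g" "L2_eq a b f g" "x \<in> {a..b}"
  shows "f x = g x"
proof -
  have cont: "continuous_on {a..b} (\<lambda>x. \<bar>f x - g x\<bar>)"
    using assms by (intro continuous_intros)
  have "integral\<^sup>L (lebesgue_on {a..b}) (\<lambda>x. \<bar>f x - g x\<bar>) = 0"
    using integral_nonneg_eq_0_iff_AE[OF continuous_imp_integrable_real[OF cont]] assms(4)
    by (simp add: L2_eq_def)
  then show ?thesis
    using integralL_eq_0_iff[OF cont assms(1)] assms(5) by simp
qed

section \<open>Smooth functions of compact support\<close>

text \<open>
  Smoothness by coinduction: a class of functions that contains a derivative of each of its members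
  consists of smooth functions. Explicit formulas for the higher derivatives are thereby avoided.
\<close>

lemma smooth_if_derivative_closed:
  assumes "P f"
    and step: "\<And>g. P g \<Longrightarrow> \<exists>g'. P g' \<and> (\<forall>x. (g has_real_derivative g' x) (at x))"
  shows "(deriv ^^ n) f field_differentiable (at x)"
proof -
  have deriv: "P (deriv g)" if Pg: "P g" for g
  proof -
    obtain g' where g': "P g'" "\<And>x. (g has_real_derivative g' x) (at x)"
      using step[OF Pg] by blast
    then have "deriv g = g'"
      by (auto intro!: ext DERIV_imp_deriv)
    then show ?thesis using g' by simp
  qed
  have "P ((deriv ^^ n) f)"
    by (induction n) (use \<open>P f\<close> deriv in auto)
  then show ?thesis
    using step unfolding field_differentiable_def by blast
qed

lemma test_function_has_derivative:
  assumes "test_function a b \<theta>"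
  shows "((deriv ^^ n) \<theta> has_real_derivative (deriv ^^ Suc n) \<theta> x) (at x)"
  using assms by (auto simp: test_function_def intro: field_differentiable_derivI)

lemma test_function_continuous:
  assumes "test_function a b \<theta>"
  shows "continuous_on S ((deriv ^^ n) \<theta>)"
  using test_function_has_derivative[OF assms]
  by (meson DERIV_continuous_on has_field_derivative_at_within)

lemma test_function_L2_space:
  assumes "test_function a b \<theta>"
  shows "\<theta> \<in> L2_space a b" "deriv \<theta> \<in> L2_space a b"
  using test_function_continuous[OF assms, of "{a..b}" 0]
    test_function_continuous[OF assms, of "{a..b}" 1]
  by (auto intro: continuous_imp_L2_space)

text \<open>
  The definition of a test function allows \<open>d < c\<close>, which forces \<open>\<theta> = 0\<close>; enlarging the interval by the
  midpoint of \<open>[a,b]\<close> makes it nonempty.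
\<close>

lemma test_function_support:
  assumes "test_function a b \<theta>" "a < b"
  obtains c d where "a < c" "c \<le> d" "d < b" "\<And>x. x \<notin> {c..d} \<Longrightarrow> \<theta> x = 0"
proof -
  obtain c d where cd: "a < c" "d < b" and zero: "\<And>x. x \<notin> {c..d} \<Longrightarrow> \<theta> x = 0"
    using assms(1) unfolding test_function_def by blast
  show thesis
  proof (rule that[of "min c ((a + b) / 2)" "max d ((a + b) / 2)"])
    show "\<theta> x = 0" if "x \<notin> {min c ((a + b) / 2)..max d ((a + b) / 2)}" for x
      by (rule zero) (use that in auto)
  qed (use cd \<open>a < b\<close> in auto)
qed

lemma test_function_diff_scale:
  assumes "test_function a b \<theta>" "test_function a b \<rho>" "a < b"
  shows "test_function a b (\<lambda>x. \<theta> x - K * \<rho> x)"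
proof -
  define P where "P g \<longleftrightarrow> (\<exists>n. g = (\<lambda>x. (deriv ^^ n) \<theta> x - K * (deriv ^^ n) \<rho> x))" for g
  have "(deriv ^^ n) (\<lambda>x. \<theta> x - K * \<rho> x) field_differentiable (at x)" for n x
  proof (rule smooth_if_derivative_closed[of P])
    show "P (\<lambda>x. \<theta> x - K * \<rho> x)"
      unfolding P_def by (intro exI[of _ 0]) simp
  next
    fix g assume "P g"
    then obtain n where "g = (\<lambda>x. (deriv ^^ n) \<theta> x - K * (deriv ^^ n) \<rho> x)"
      unfolding P_def by blast
    then have "(g has_real_derivative (deriv ^^ Suc n) \<theta> x - K * (deriv ^^ Suc n) \<rho> x) (at x)" for x
      using test_function_has_derivative[OF assms(1)] test_function_has_derivative[OF assms(2)]
      by (auto intro!: derivative_intros DERIV_cmult)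
    then show "\<exists>g'. P g' \<and> (\<forall>x. (g has_real_derivative g' x) (at x))"
      unfolding P_def by blast
  qed
  moreover have "\<exists>c d. a < c \<and> d < b \<and> (\<forall>x. x \<notin> {c..d} \<longrightarrow> \<theta> x - K * \<rho> x = 0)"
  proof -
    obtain c d where cd: "a < c" "d < b" "\<And>x. x \<notin> {c..d} \<Longrightarrow> \<theta> x = 0"
      using test_function_support[OF assms(1,3)] by metis
    obtain c' d' where cd': "a < c'" "d' < b" "\<And>x. x \<notin> {c'..d'} \<Longrightarrow> \<rho> x = 0"
      using test_function_support[OF assms(2,3)] by metis
    have "\<theta> x - K * \<rho> x = 0" if "x \<notin> {min c c'..max d d'}" for x
    proof -
      have "x \<notin> {c..d}" "x \<notin> {c'..d'}"
        using that by auto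
      then show ?thesis
        using cd(3) cd'(3) by simp
    qed
    then show ?thesis
      using cd(1,2) cd'(1,2) by (intro exI[of _ "min c c'"] exI[of _ "max d d'"]) auto
  qed
  ultimately show ?thesis
    unfolding test_function_def by blast
qed

text \<open>
  A primitive of \<open>\<theta>\<close> is constant to the right of the support of \<open>\<theta>\<close>, and the constant is the integral of
  \<open>\<theta>\<close>; when it vanishes the primitive has compact support again.
\<close>

lemma test_function_primitive:
  assumes "test_function a b \<theta>" "a < b" and zero: "(LINT x|lebesgue_on {a..b}. \<theta> x) = 0"
  obtains \<Theta> where "test_function a b \<Theta>" "deriv \<Theta> = \<theta>"
proof -
  obtain c d where cd: "a < c" "c \<le> d" "d < b" "\<And>x. x \<notin> {c..d} \<Longrightarrow> \<theta> x = 0"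
    using test_function_support[OF assms(1,2)] by metis
  have cont: "continuous_on S \<theta>" for S
    using test_function_continuous[OF assms(1), of S 0] by simp
  define \<Theta> where "\<Theta> x = integral {a..x} \<theta>" for x
  have left: "\<Theta> x = 0" if "x < c" for x
    unfolding \<Theta>_def using cd that by (intro integral_eq_zero_null_sets integral_unique has_integral_is_0) auto
  have right: "\<Theta> x = 0" if "x > d" for x
  proof -
    have const: "integral {a..y} \<theta> = integral {a..d} \<theta>" if "y > d" for y
    proof -
      have "integral {a..d} \<theta> + integral {d..y} \<theta> = integral {a..y} \<theta>"
        using that cd by (intro Henstock_Kurzweil_Integration.integral_combine integrable_continuous_real cont) auto
      moreover have "integral {d..y} \<theta> = integral {d..y} (\<lambda>x. 0)"
        using cd by (intro integral_spike[of "{d}"]) auto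
      ultimately show ?thesis by simp
    qed
    have "integral {a..b} \<theta> = 0"
      using zero lebesgue_integral_eq_integral[OF continuous_imp_integrable_real[OF cont]] by simp
    then show ?thesis
      using const[of x] const[of b] that cd by (simp add: \<Theta>_def)
  qed
  have "(\<Theta> has_real_derivative \<theta> x) (at x)" for x
  proof (cases "x < c")
    case True
    show ?thesis
    proof (rule has_field_derivative_transform_within_open[where f = "\<lambda>x. 0" and S = "{..<c}"])
      show "((\<lambda>x. 0) has_real_derivative \<theta> x) (at x)"
        using cd(4)[of x] True by auto
    qed (use True left in auto)
  next
    case False
    have "(\<Theta> has_real_derivative \<theta> x) (at x within {a..x + 1})"
      unfolding \<Theta>_def using False cd by (intro integral_has_real_derivative cont) auto
    moreover have "at x within {a..x + 1} = at x"
      using False cd by (intro at_within_interior) auto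
    ultimately show ?thesis by simp
  qed
  note der = this
  then have deriv_eq: "deriv \<Theta> = \<theta>"
    by (auto intro!: ext DERIV_imp_deriv)
  have "(deriv ^^ n) \<Theta> field_differentiable (at x)" for n x
  proof (cases n)
    case 0
    then show ?thesis using der[of x] by (auto simp: field_differentiable_def)
  next
    case (Suc m)
    then have "(deriv ^^ n) \<Theta> = (deriv ^^ m) \<theta>"
      using deriv_eq by (simp add: funpow_Suc_right del: funpow.simps)
    then show ?thesis using assms(1) by (simp add: test_function_def)
  qed
  moreover have "\<exists>c d. a < c \<and> d < b \<and> (\<forall>x. x \<notin> {c..d} \<longrightarrow> \<Theta> x = 0)"
    using cd left right by (intro exI[of _ c] exI[of _ d]) auto
  ultimately show thesis
    using deriv_eq by (intro that) (auto simp: test_function_def)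
qed

text \<open>
  The classical smooth function that is flat at the origin, with a factor \<open>t\<^sup>-\<^sup>k\<close> so that the family is
  stable under differentiation up to polynomial factors. The parameter \<open>s\<close> is sent to zero later, to
  approximate indicator functions.
\<close>

definition flat_exp :: "real \<Rightarrow> nat \<Rightarrow> real \<Rightarrow> real" where
  "flat_exp s k t = (if t > 0 then exp (- (s / t)) / t ^ k else 0)"

text \<open>
  After the substitution \<open>y = 1 / t\<close> this says that the exponential beats every power.
\<close>

lemma flat_exp_tendsto_0:
  assumes "s > 0"
  shows "(flat_exp s k \<longlongrightarrow> 0) (at 0)"
proof (rule filterlim_split_at)
  show "(flat_exp s k \<longlongrightarrow> 0) (at_left 0)"
    by (rule tendsto_eventually)
      (auto simp: flat_exp_def eventually_at_filter)
  have "filterlim (\<lambda>y. s * y) at_top at_top"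
    using assms by (intro filterlim_tendsto_pos_mult_at_top[OF tendsto_const _ filterlim_ident]) auto
  from filterlim_compose[OF tendsto_power_div_exp_0[of k] this]
  have "((\<lambda>y. inverse (s ^ k) * ((s * y) ^ k / exp (s * y))) \<longlongrightarrow> inverse (s ^ k) * 0) at_top"
    by (intro tendsto_intros)
  moreover have "\<forall>\<^sub>F y in at_top. inverse (s ^ k) * ((s * y) ^ k / exp (s * y))
      = flat_exp s k (inverse y)"
    using eventually_gt_at_top[of 0]
    by eventually_elim
      (use assms in \<open>auto simp: flat_exp_def field_simps exp_minus power_mult_distrib\<close>)
  ultimately have "((\<lambda>y. flat_exp s k (inverse y)) \<longlongrightarrow> 0) at_top"
    by (simp add: filterlim_cong)
  then show "(flat_exp s k \<longlongrightarrow> 0) (at_right 0)"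
    by (simp add: filterlim_at_right_to_top)
qed

lemma flat_exp_eq_mult_Suc: "flat_exp s k t = t * flat_exp s (Suc k) t"
  by (simp add: flat_exp_def)

text \<open>
  At the origin the difference quotient of \<open>flat_exp s k\<close> is \<open>flat_exp s (Suc k)\<close>, which tends to zero.
  Writing the derivative with the single factor \<open>flat_exp s (Suc (Suc k))\<close> keeps functions of the form
  polynomial times \<open>flat_exp\<close> within that form.
\<close>

lemma flat_exp_has_derivative:
  assumes "s > 0"
  shows "(flat_exp s k has_real_derivative
      (s - real k * t) * flat_exp s (Suc (Suc k)) t) (at t)"
proof -
  consider "t > 0" | "t = 0" | "t < 0" by linarith
  then show ?thesis
  proof cases
    case 1
    have pow: "((\<lambda>t. t ^ k) has_real_derivative real k * t ^ k / t) (at t)"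
      using DERIV_power[OF DERIV_ident, of k t] 1 by (cases k) auto
    have "((\<lambda>t. exp (- (s / t))) has_real_derivative exp (- (s / t)) * (s / t\<^sup>2)) (at t)"
      using 1 by (auto intro!: derivative_eq_intros simp: field_simps power2_eq_square)
    from DERIV_divide[OF this pow]
    have "((\<lambda>t. exp (- (s / t)) / t ^ k) has_real_derivative
        (s - real k * t) * (exp (- (s / t)) / t ^ Suc (Suc k))) (at t)"
      by (rule DERIV_cong) (use 1 in \<open>auto simp: field_simps power2_eq_square\<close>)
    then have "(flat_exp s k has_real_derivative
        (s - real k * t) * (exp (- (s / t)) / t ^ Suc (Suc k))) (at t)"
      by (rule has_field_derivative_transform_within_open[where S = "{0<..}"])
        (use 1 in \<open>auto simp: flat_exp_def\<close>)
    then show ?thesis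
      using 1 by (simp add: flat_exp_def)
  next
    case 2
    have "((\<lambda>h. (flat_exp s k (0 + h) - flat_exp s k 0) / h) \<longlongrightarrow> 0) (at 0)"
    proof (rule Lim_transform_eventually[OF flat_exp_tendsto_0[OF assms, of "Suc k"]])
      show "\<forall>\<^sub>F h in at 0. flat_exp s (Suc k) h = (flat_exp s k (0 + h) - flat_exp s k 0) / h"
        by (auto simp: eventually_at_filter flat_exp_def)
    qed
    then show ?thesis
      using 2 by (simp add: DERIV_def flat_exp_def)
  next
    case 3
    show ?thesis
      by (rule has_field_derivative_transform_within_open[where f = "\<lambda>x. 0" and S = "{..<0}"])
        (use 3 in \<open>auto simp: flat_exp_def\<close>)
  qed
qed

text \<open>
  For \<open>c < d\<close> the quadratic \<open>q x = (x - c) * (d - x)\<close> is positive exactly on \<open>(c,d)\<close>. The functions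
  \<open>p x * flat_exp s k (q x)\<close> with \<open>p\<close> a polynomial form a class closed under differentiation.
\<close>

lemma test_function_bump:
  assumes "a < c" "c < d" "d < b" "s > 0"
  shows "test_function a b (\<lambda>x. flat_exp s 0 ((x - c) * (d - x)))"
proof -
  define q where "q = [:- c, 1:] * [:d, - 1:]"
  have q: "poly q x = (x - c) * (d - x)" for x
    by (simp add: q_def algebra_simps)
  define P where "P g \<longleftrightarrow> (\<exists>p k. g = (\<lambda>x. poly p x * flat_exp s k (poly q x)))" for g
  have "(deriv ^^ n) (\<lambda>x. flat_exp s 0 (poly q x)) field_differentiable (at x)" for n x
  proof (rule smooth_if_derivative_closed[of P])
    show "P (\<lambda>x. flat_exp s 0 (poly q x))"
      unfolding P_def by (intro exI[of _ 1] exI[of _ 0]) simp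
  next
    fix g assume "P g"
    then obtain p k where g: "g = (\<lambda>x. poly p x * flat_exp s k (poly q x))"
      unfolding P_def by blast
    \<comment> \<open>The numerator after \<open>flat_exp s k\<close> has been rewritten as \<open>q\<^sup>2\<close> times \<open>flat_exp s (Suc (Suc k))\<close>.\<close>
    define p' where "p' = pderiv p * q\<^sup>2 + p * (([:s:] - [:real k:] * q) * pderiv q)"
    have "(g has_real_derivative poly p' x * flat_exp s (Suc (Suc k)) (poly q x)) (at x)" for x
    proof -
      have "(g has_real_derivative
          poly (pderiv p) x * flat_exp s k (poly q x)
          + ((s - real k * poly q x) * flat_exp s (Suc (Suc k)) (poly q x) * poly (pderiv q) x) * poly p x) (at x)"
        unfolding g
        by (intro DERIV_mult poly_DERIV DERIV_chain2[OF flat_exp_has_derivative[OF assms(4)]])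
      moreover have "flat_exp s k (poly q x) = (poly q x)\<^sup>2 * flat_exp s (Suc (Suc k)) (poly q x)"
        using flat_exp_eq_mult_Suc[of s k] flat_exp_eq_mult_Suc[of s "Suc k"]
        by (simp add: power2_eq_square)
      ultimately show ?thesis
        by (elim DERIV_cong) (simp add: p'_def algebra_simps)
    qed
    then show "\<exists>g'. P g' \<and> (\<forall>x. (g has_real_derivative g' x) (at x))"
      unfolding P_def by blast
  qed
  moreover have "flat_exp s 0 (poly q x) = 0" if "x \<notin> {c..d}" for x
    using that assms(2) by (auto simp: q flat_exp_def zero_less_mult_iff)
  ultimately show ?thesis
    using assms unfolding test_function_def q[symmetric] by blast
qed

section \<open>Weak derivatives\<close>

lemma lebesgue_integral_subinterval:
  fixes f :: "real \<Rightarrow> real"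
  assumes "integrable (lebesgue_on {a..b}) f" "{c..d} \<subseteq> {a..b}"
  shows "(LINT x|lebesgue_on {a..b}. (if x \<in> {c..d} then f x else 0)) = integral {c..d} f"
    and "integrable (lebesgue_on {a..b}) (\<lambda>x. if x \<in> {c..d} then f x else 0)"
proof -
  show int: "integrable (lebesgue_on {a..b}) (\<lambda>x. if x \<in> {c..d} then f x else 0)"
  proof (rule Bochner_Integration.integrable_bound[OF assms(1)])
    have [measurable]: "f \<in> borel_measurable (lebesgue_on {a..b})"
      using assms(1) by simp
    have [measurable]: "(\<lambda>x. x) \<in> borel_measurable (lebesgue_on {a..b})"
      by (simp add: continuous_imp_measurable_on_sets_lebesgue)
    show "(\<lambda>x. if x \<in> {c..d} then f x else 0) \<in> borel_measurable (lebesgue_on {a..b})"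
      unfolding atLeastAtMost_iff by measurable
  qed auto
  show "(LINT x|lebesgue_on {a..b}. (if x \<in> {c..d} then f x else 0)) = integral {c..d} f"
    using integral_restrict_Int[of "{a..b}" "{c..d}" f] Int_absorb2[OF assms(2)]
    by (simp only: lebesgue_integral_eq_integral[OF int] sets_completionI_sets lborelD sets_lborel
        borel_closed closed_atLeastAtMost)
qed

text \<open>
  For \<open>t > 0\<close> the value \<open>exp (- s / t)\<close> tends to \<open>1\<close> as \<open>s\<close> tends to \<open>0\<close>. Hence the bumps on \<open>(c,d)\<close> converge
  boundedly to the indicator of \<open>(c,d)\<close>.
\<close>

lemma flat_exp_tendsto_indicator:
  "(\<lambda>n. flat_exp (1 / real (Suc n)) 0 t) \<longlonglongrightarrow> (if t > 0 then 1 else 0)"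
proof (cases "t > 0")
  case True
  have "(\<lambda>n. exp (- (1 / real (Suc n) / t))) \<longlonglongrightarrow> exp (- (0 / t))"
    by (intro tendsto_intros LIMSEQ_Suc lim_1_over_n) (use True in auto)
  then show ?thesis using True by (simp add: flat_exp_def)
qed (simp add: flat_exp_def)

lemma vanishing_interval_integral_if_orthogonal_to_test_functions:
  assumes "v \<in> L2_space a b"
    and orth: "\<And>\<theta>. test_function a b \<theta> \<Longrightarrow> L2_inner a b v \<theta> = 0"
    and cd: "a < c" "c < d" "d < b"
  shows "integral {c..d} v = 0"
proof -
  define \<theta> where "\<theta> n x = flat_exp (1 / real (Suc n)) 0 ((x - c) * (d - x))" for n x
  have test: "test_function a b (\<theta> n)" for n
    unfolding \<theta>_def using cd by (intro test_function_bump) auto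
  have int: "integrable (lebesgue_on {a..b}) v"
    using assms(1) by (rule L2_space_integrable)
  have lim: "(\<lambda>n. \<theta> n x) \<longlonglongrightarrow> indicator {c<..<d} x" for x
  proof -
    have "(x - c) * (d - x) > 0 \<longleftrightarrow> x \<in> {c<..<d}"
      using cd unfolding zero_less_mult_iff greaterThanLessThan_iff by linarith
    then show ?thesis
      using flat_exp_tendsto_indicator[of "(x - c) * (d - x)"]
      unfolding \<theta>_def by (simp only: indicator_def of_bool_def)
  qed
  have meas: "(\<lambda>x. v x * \<theta> n x) \<in> borel_measurable (lebesgue_on {a..b})" for n
    using L2_mult_integrable[OF assms(1) test_function_L2_space(1)[OF test]] by simp
  have meas_lim: "(\<lambda>x. v x * indicator {c<..<d} x) \<in> borel_measurable (lebesgue_on {a..b})"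
    by (rule borel_measurable_LIMSEQ_real[where u = "\<lambda>n x. v x * \<theta> n x", OF _ meas])
      (intro tendsto_intros lim)
  have "(\<lambda>n. LINT x|lebesgue_on {a..b}. v x * \<theta> n x)
      \<longlonglongrightarrow> (LINT x|lebesgue_on {a..b}. v x * indicator {c<..<d} x)"
  proof (rule integral_dominated_convergence[where w = "\<lambda>x. \<bar>v x\<bar>"])
    show "AE x in lebesgue_on {a..b}. (\<lambda>n. v x * \<theta> n x) \<longlonglongrightarrow> v x * indicator {c<..<d} x"
      by (intro AE_I2 tendsto_intros lim)
    have "\<bar>\<theta> n x\<bar> \<le> 1" for n x
      by (simp add: \<theta>_def flat_exp_def)
    then show "AE x in lebesgue_on {a..b}. norm (v x * \<theta> n x) \<le> \<bar>v x\<bar>" for n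
      by (auto simp: abs_mult mult_left_le)
  qed (use int meas meas_lim in auto)
  then have "(LINT x|lebesgue_on {a..b}. v x * indicator {c<..<d} x) = 0"
    using orth[OF test] by (simp add: L2_inner_def LIMSEQ_const_iff)
  moreover have "(LINT x|lebesgue_on {a..b}. v x * indicator {c<..<d} x)
      = (LINT x|lebesgue_on {a..b}. (if x \<in> {c..d} then v x else 0))"
  proof (rule integral_cong_AE)
    have "AE x in lebesgue_on {a..b}. x \<noteq> c \<and> x \<noteq> d"
    proof (rule AE_I')
      show "{c, d} \<in> null_sets (lebesgue_on {a..b})"
        using cd by (subst null_sets_restrict_space) (auto simp: negligible_iff_null_sets[symmetric])
    qed auto
    then show "AE x in lebesgue_on {a..b}.
        v x * indicator {c<..<d} x = (if x \<in> {c..d} then v x else 0)"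
      by eventually_elim (auto simp: indicator_def)
    show "(\<lambda>x. if x \<in> {c..d} then v x else 0) \<in> borel_measurable (lebesgue_on {a..b})"
      using lebesgue_integral_subinterval(2)[OF int, of c d] cd by simp
  qed (fact meas_lim)
  ultimately show ?thesis
    using lebesgue_integral_subinterval(1)[OF int, of c d] cd by simp
qed

text \<open>
  The fundamental lemma of the calculus of variations. Bumps approximate indicators, so the
  integral of \<open>v\<close> over every compact subinterval of \<open>(a,b)\<close> vanishes; by Lebesgue differentiation so does
  \<open>v\<close> almost everywhere.
\<close>

lemma L2_eq_0_if_orthogonal_to_test_functions:
  assumes "v \<in> L2_space a b"
    and orth: "\<And>\<theta>. test_function a b \<theta> \<Longrightarrow> L2_inner a b v \<theta> = 0"
  shows "L2_eq a b v (\<lambda>x. 0)"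
proof -
  define w where "w x = (if x \<in> {a..b} then v x else 0)" for x
  have "v integrable_on {a..b}"
    using L2_space_integrable[OF assms(1)] by (rule integrable_on_lebesgue_on) simp
  then have "w integrable_on UNIV"
    unfolding w_def using integrable_restrict_UNIV by blast
  then have w_int: "w integrable_on cbox p q" for p q
    by (rule integrable_on_subcbox) simp
  obtain N where N: "negligible N"
    "\<And>x e. \<lbrakk>x \<notin> N; 0 < e\<rbrakk> \<Longrightarrow> \<exists>d>0. \<forall>h. 0 < h \<and> h < d \<longrightarrow>
       norm (integral (cbox x (x + h *\<^sub>R One)) w /\<^sub>R h ^ DIM(real) - w x) < e"
    using integrable_ccontinuous_explicit[OF w_int] by metis
  have zero: "v x = 0" if "x \<notin> N \<union> {a, b}" "x \<in> {a..b}" for x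
  proof (rule ccontr)
    assume "v x \<noteq> 0"
    then have "\<bar>w x\<bar> > 0"
      using that by (simp add: w_def)
    moreover have "x \<notin> N"
      using that by simp
    ultimately have "\<exists>d>0. \<forall>h. 0 < h \<and> h < d \<longrightarrow>
        norm (integral (cbox x (x + h *\<^sub>R One)) w /\<^sub>R h ^ DIM(real) - w x) < \<bar>w x\<bar>"
      using N(2) by simp
    then obtain d where d: "d > 0" "\<forall>h. 0 < h \<and> h < d \<longrightarrow>
        norm (integral (cbox x (x + h *\<^sub>R One)) w /\<^sub>R h ^ DIM(real) - w x) < \<bar>w x\<bar>"
      by (elim exE conjE)
    \<comment> \<open>Small enough for the differentiation estimate and for \<open>[x,x + h]\<close> to stay inside \<open>(a,b)\<close>.\<close>
    define h where "h = min d (b - x) / 2"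
    have h: "0 < h" "h < d" "x + h < b" "a < x"
      using d(1) that min.cobounded1[of d "b - x"] min.cobounded2[of d "b - x"]
      by (auto simp: h_def simp del: min.cobounded1 min.cobounded2)
    have "integral {x..x + h} w = integral {x..x + h} v"
      using h by (intro integral_cong) (auto simp: w_def)
    also have "\<dots> = 0"
      by (rule vanishing_interval_integral_if_orthogonal_to_test_functions[OF assms])
        (use h in auto)
    finally show False
      using d(2)[rule_format, OF conjI[OF h(1,2)]] by simp
  qed
  have "AE x in lebesgue. x \<notin> N \<union> {a, b}"
    using N(1) by (intro AE_I'[of "N \<union> {a, b}"]) (auto simp: negligible_iff_null_sets[symmetric])
  then have "AE x in lebesgue. x \<in> {a..b} \<longrightarrow> v x = 0"
    by eventually_elim (use zero in blast)
  then show ?thesis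
    by (simp add: L2_eq_def AE_restrict_space_iff)
qed

lemma L2_eq_sym: "L2_eq a b f g \<Longrightarrow> L2_eq a b g f"
  by (auto simp: L2_eq_def)

lemma L2_eq_trans: "L2_eq a b f g \<Longrightarrow> L2_eq a b g h \<Longrightarrow> L2_eq a b f h"
  unfolding L2_eq_def by (rule AE_mp, assumption, erule AE_mp) simp

lemma L2_eq_refl: "L2_eq a b f f"
  by (simp add: L2_eq_def)

lemma L2_eq_lincomb:
  "L2_eq a b f f' \<Longrightarrow> L2_eq a b g g' \<Longrightarrow>
    L2_eq a b (\<lambda>x. c * f x + d * g x) (\<lambda>x. c * f' x + d * g' x)"
  unfolding L2_eq_def by (rule AE_mp, assumption, erule AE_mp) simp

text \<open>
  The factors \<open>1\<close> and \<open>-1\<close> make the difference an instance of the linear combinations in the lemmas on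
  linearity.
\<close>

lemma L2_eq_iff_diff: "L2_eq a b f g \<longleftrightarrow> L2_eq a b (\<lambda>x. 1 * f x + (- 1) * g x) (\<lambda>x. 0)"
  by (simp add: L2_eq_def)

lemma has_weak_deriv_lincomb:
  assumes "has_weak_deriv a b y v" "has_weak_deriv a b z w"
  shows "has_weak_deriv a b (\<lambda>x. c * y x + d * z x) (\<lambda>x. c * v x + d * w x)"
  unfolding has_weak_deriv_def
proof (intro conjI allI impI)
  have L2: "y \<in> L2_space a b" "v \<in> L2_space a b" "z \<in> L2_space a b" "w \<in> L2_space a b"
    using assms by (simp_all add: has_weak_deriv_def)
  then show "(\<lambda>x. c * y x + d * z x) \<in> L2_space a b" "(\<lambda>x. c * v x + d * w x) \<in> L2_space a b"
    by (intro L2_space_lincomb; simp)+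
  fix \<theta> assume \<theta>: "test_function a b \<theta>"
  then have "L2_inner a b y (deriv \<theta>) = - L2_inner a b v \<theta>"
    "L2_inner a b z (deriv \<theta>) = - L2_inner a b w \<theta>"
    using assms by (simp_all add: has_weak_deriv_def)
  then show "L2_inner a b (\<lambda>x. c * y x + d * z x) (deriv \<theta>)
      = - L2_inner a b (\<lambda>x. c * v x + d * w x) \<theta>"
    using test_function_L2_space[OF \<theta>] L2 by (simp add: L2_inner_lincomb_left)
qed

lemma has_weak_deriv_cong:
  assumes "has_weak_deriv a b y v" "L2_eq a b y y'" "y' \<in> L2_space a b"
    "L2_eq a b v v'" "v' \<in> L2_space a b"
  shows "has_weak_deriv a b y' v'"
  unfolding has_weak_deriv_def
proof (intro conjI allI impI)
  have L2: "y \<in> L2_space a b" "v \<in> L2_space a b"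
    using assms(1) by (simp_all add: has_weak_deriv_def)
  fix \<theta> assume \<theta>: "test_function a b \<theta>"
  note \<theta>2 = test_function_L2_space[OF \<theta>]
  have "L2_inner a b y (deriv \<theta>) = - L2_inner a b v \<theta>"
    using assms(1) \<theta> by (simp add: has_weak_deriv_def)
  then show "L2_inner a b y' (deriv \<theta>) = - L2_inner a b v' \<theta>"
    using L2_inner_cong[OF L2(1) assms(3) \<theta>2(2,2) assms(2) L2_eq_refl]
      L2_inner_cong[OF L2(2) assms(5) \<theta>2(1,1) assms(4) L2_eq_refl] by simp
qed (fact assms)+

lemma has_weak_deriv_unique:
  assumes "has_weak_deriv a b y v" "has_weak_deriv a b y w"
  shows "L2_eq a b v w"
  unfolding L2_eq_iff_diff[of a b v w]
proof (rule L2_eq_0_if_orthogonal_to_test_functions)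
  have zero: "has_weak_deriv a b (\<lambda>x. 1 * y x + (- 1) * y x) (\<lambda>x. 1 * v x + (- 1) * w x)"
    using assms by (rule has_weak_deriv_lincomb)
  then show "(\<lambda>x. 1 * v x + (- 1) * w x) \<in> L2_space a b"
    by (simp add: has_weak_deriv_def)
  show "L2_inner a b (\<lambda>x. 1 * v x + (- 1) * w x) \<theta> = 0" if "test_function a b \<theta>" for \<theta>
  proof -
    have "L2_inner a b (\<lambda>x. 1 * y x + (- 1) * y x) (deriv \<theta>)
        = - L2_inner a b (\<lambda>x. 1 * v x + (- 1) * w x) \<theta>"
      using zero that unfolding has_weak_deriv_def by blast
    moreover have "L2_inner a b (\<lambda>x. 1 * y x + (- 1) * y x) (deriv \<theta>) = 0"
      by (simp add: L2_inner_def)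
    ultimately show ?thesis by linarith
  qed
qed

lemma has_weak_deriv_weak_deriv:
  "has_weak_deriv a b y v \<Longrightarrow> has_weak_deriv a b y (weak_deriv a b y)"
  unfolding weak_deriv_def by (rule someI[of "has_weak_deriv a b y"])

text \<open>
  The lemma of du Bois-Reymond. Fix a bump \<open>\<rho>\<close> with integral \<open>R\<close>, which is positive. For a test function \<open>\<theta>\<close>,
  subtracting the multiple of \<open>\<rho>\<close> with the same integral leaves the derivative of a test function, to
  which \<open>y\<close> is orthogonal. Hence \<open>y\<close> and the constant \<open>C = (y, \<rho>) / R\<close> have the same inner product with
  every test function.
\<close>

lemma has_weak_deriv_0_imp_constant:
  assumes "a < b" "has_weak_deriv a b y (\<lambda>x. 0)"
  obtains C where "L2_eq a b y (\<lambda>x. C)"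
proof -
  \<comment> \<open>The middle third of \<open>[a,b]\<close>; any compact subinterval of \<open>(a,b)\<close> would do.\<close>
  define \<rho> where "\<rho> x = flat_exp 1 0 ((x - (2 * a + b) / 3) * ((a + 2 * b) / 3 - x))" for x
  have \<rho>: "test_function a b \<rho>"
    unfolding \<rho>_def using assms(1) by (intro test_function_bump) auto
  have cont: "continuous_on {a..b} \<rho>"
    using test_function_continuous[OF \<rho>, of _ 0] by simp
  define R where "R = (LINT x|lebesgue_on {a..b}. \<rho> x)"
  have "0 < ((a + b) / 2 - (2 * a + b) / 3) * ((a + 2 * b) / 3 - (a + b) / 2)"
    using assms(1) by (intro mult_pos_pos) auto
  then have "\<rho> ((a + b) / 2) \<noteq> 0"
    unfolding \<rho>_def flat_exp_def by simp
  moreover have "(a + b) / 2 \<in> {a..b}"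
    using assms(1) by simp
  ultimately have "\<not> (\<forall>x\<in>{a..b}. \<rho> x = 0)"
    by blast
  moreover have "\<rho> x \<ge> 0" for x
    by (simp add: \<rho>_def flat_exp_def)
  ultimately have R: "R \<noteq> 0"
    using integralL_eq_0_iff[OF cont assms(1)] unfolding R_def by blast
  have y: "y \<in> L2_space a b"
    using assms(2) by (simp add: has_weak_deriv_def)
  have one: "(\<lambda>x. 1) \<in> L2_space a b"
    by (intro continuous_imp_L2_space) simp
  define C where "C = L2_inner a b y \<rho> / R"
  have "L2_eq a b (\<lambda>x. 1 * y x + (- C) * 1) (\<lambda>x. 0)"
  proof (rule L2_eq_0_if_orthogonal_to_test_functions)
    show "(\<lambda>x. 1 * y x + (- C) * 1) \<in> L2_space a b"
      by (intro L2_space_lincomb y one)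
    fix \<theta> assume \<theta>: "test_function a b \<theta>"
    define K where "K = (LINT x|lebesgue_on {a..b}. \<theta> x) / R"
    note \<theta>2 = test_function_L2_space(1)[OF \<theta>] and \<rho>2 = test_function_L2_space(1)[OF \<rho>]
    have "test_function a b (\<lambda>x. \<theta> x - K * \<rho> x)"
      by (intro test_function_diff_scale \<theta> \<rho> assms(1))
    moreover have "(LINT x|lebesgue_on {a..b}. \<theta> x - K * \<rho> x) = 0"
      using L2_space_integrable[OF \<theta>2] L2_space_integrable[OF \<rho>2] R
      by (simp add: K_def R_def[symmetric])
    ultimately obtain \<Theta> where "test_function a b \<Theta>" "deriv \<Theta> = (\<lambda>x. \<theta> x - K * \<rho> x)"
      using test_function_primitive assms(1) by metis
    then have "L2_inner a b y (\<lambda>x. \<theta> x - K * \<rho> x) = 0"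
      using assms(2) by (auto simp: has_weak_deriv_def L2_inner_def)
    then have "L2_inner a b y \<theta> = K * L2_inner a b y \<rho>"
      using L2_inner_lincomb_left[OF \<theta>2 \<rho>2 y, of 1 "- K"]
      by (simp add: L2_inner_commute[of a b y])
    also have "\<dots> = C * L2_inner a b (\<lambda>x. 1) \<theta>"
      by (simp add: K_def C_def L2_inner_def)
    finally show "L2_inner a b (\<lambda>x. 1 * y x + (- C) * 1) \<theta> = 0"
      unfolding L2_inner_lincomb_left[OF y one \<theta>2] by simp
  qed
  then show thesis
    using L2_eq_iff_diff[of a b y "\<lambda>x. C"] that by simp
qed

text \<open>
  An indefinite Lebesgue integral is differentiable only almost everywhere, so classical integration
  by parts does not apply. Instead write both sides as iterated integrals of \<open>f t * z' x\<close> over the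
  triangle \<open>t \<le> x\<close> and exchange the order of integration; the boundary terms vanish with \<open>z\<close>.
\<close>

lemma indefinite_integral_by_parts:
  fixes f z z' :: "real \<Rightarrow> real"
  assumes "a \<le> b" and f: "integrable (lebesgue_on {a..b}) f"
    and z': "continuous_on {a..b} z'"
    and deriv: "\<And>x. x \<in> {a..b} \<Longrightarrow> (z has_real_derivative z' x) (at x within {a..b})"
    and "z a = 0" "z b = 0"
  shows "(LINT x|lebesgue_on {a..b}. (C + integral {a..x} f) * z' x)
    = - (LINT x|lebesgue_on {a..b}. f x * z x)"
proof -
  let ?M = "lebesgue_on {a..b}"
  interpret M: finite_measure ?M
    by (rule finite_measure_lebesgue_on_interval)
  interpret pair_sigma_finite ?M ?M ..
  have z'_int: "integrable ?M z'"
    using z' by (rule continuous_imp_integrable_real)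
  have [measurable]: "f \<in> borel_measurable ?M" "z' \<in> borel_measurable ?M"
    using f z'_int by auto
  have [measurable]: "(\<lambda>x. x) \<in> borel_measurable ?M"
    by (simp add: continuous_imp_measurable_on_sets_lebesgue)
  have vderiv: "(z has_vector_derivative z' x) (at x within {a..b})" if "x \<in> {a..b}" for x
    using deriv[OF that] unfolding has_real_derivative_iff_has_vector_derivative .
  define H where "H t x = (if t \<le> x then f t * z' x else 0)" for t x
  have "integrable (?M \<Otimes>\<^sub>M ?M) (\<lambda>(t, x). f t * z' x)"
  proof (rule Fubini_integrable)
    show "integrable ?M (\<lambda>t. LINT x|?M. norm (case (t, x) of (t, x) \<Rightarrow> f t * z' x))"
      using f by (simp add: abs_mult)
    show "AE t in ?M. integrable ?M (\<lambda>x. case (t, x) of (t, x) \<Rightarrow> f t * z' x)"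
      using z'_int by simp
  qed measurable
  then have "integrable (?M \<Otimes>\<^sub>M ?M) (\<lambda>(t, x). H t x)"
  proof (rule Bochner_Integration.integrable_bound)
    show "(\<lambda>(t, x). H t x) \<in> borel_measurable (?M \<Otimes>\<^sub>M ?M)"
      unfolding H_def by measurable
  qed (auto simp: H_def)
  then have Fubini: "(LINT x|?M. LINT t|?M. H t x) = (LINT t|?M. LINT x|?M. H t x)"
    by (rule Fubini_integral)
  have inner_t: "(LINT t|?M. H t x) = integral {a..x} f * z' x" if "x \<in> {a..b}" for x
  proof -
    have "(LINT t|?M. H t x) = (LINT t|?M. (if t \<in> {a..x} then f t else 0) * z' x)"
      by (intro Bochner_Integration.integral_cong) (auto simp: H_def)
    also have "\<dots> = integral {a..x} f * z' x"
      using lebesgue_integral_subinterval(1)[OF f, of a x] that by simp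
    finally show ?thesis .
  qed
  have inner_x: "(LINT x|?M. H t x) = - (f t * z t)" if "t \<in> {a..b}" for t
  proof -
    have "(LINT x|?M. H t x) = (LINT x|?M. f t * (if x \<in> {t..b} then z' x else 0))"
      by (intro Bochner_Integration.integral_cong) (auto simp: H_def)
    also have "\<dots> = f t * integral {t..b} z'"
      using lebesgue_integral_subinterval(1)[OF z'_int, of t b] that by simp
    also have "integral {t..b} z' = z b - z t"
    proof (intro integral_unique fundamental_theorem_of_calculus)
      show "(z has_vector_derivative z' x) (at x within {t..b})" if "x \<in> {t..b}" for x
        by (rule has_vector_derivative_within_subset[OF vderiv])
          (use that \<open>t \<in> {a..b}\<close> in auto)
    qed (use that in auto)
    finally show ?thesis
      using assms(6) by simp
  qed
  have "continuous_on {a..b} (\<lambda>x. integral {a..x} f)"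
    using f by (intro indefinite_integral_continuous_1 integrable_on_lebesgue_on) auto
  then have int: "integrable ?M (\<lambda>x. integral {a..x} f * z' x)"
    using z' by (intro continuous_imp_integrable_real continuous_intros)
  have "(LINT x|?M. z' x) = integral {a..b} z'"
    using z'_int by (rule lebesgue_integral_eq_integral) simp
  also have "\<dots> = z b - z a"
    by (intro integral_unique fundamental_theorem_of_calculus assms(1) vderiv)
  finally have "(LINT x|?M. z' x) = 0"
    using assms(5,6) by simp
  then have "(LINT x|?M. (C + integral {a..x} f) * z' x) = (LINT x|?M. integral {a..x} f * z' x)"
    using int z'_int by (simp add: distrib_right)
  also have "\<dots> = (LINT x|?M. LINT t|?M. H t x)"
    using inner_t by (intro Bochner_Integration.integral_cong) auto
  also have "\<dots> = (LINT t|?M. - (f t * z t))"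
    unfolding Fubini using inner_x by (intro Bochner_Integration.integral_cong) auto
  finally show ?thesis by simp
qed

section \<open>The Dirichlet problem\<close>

text \<open>
  The pair \<open>(y, v)\<close> is a weak solution of \<open>-y'' = f\<close> with \<open>y a = y b = 0\<close>, where \<open>v\<close> stands for \<open>y'\<close>. Carrying
  \<open>v\<close> along makes the notion visibly linear, in contrast to the arbitrary choices made by \<open>weak_deriv\<close>
  and \<open>neg_inv_laplacian\<close>.
\<close>

definition dirichlet_solution ::
    "real \<Rightarrow> real \<Rightarrow> (real \<Rightarrow> real) \<Rightarrow> (real \<Rightarrow> real) \<Rightarrow> (real \<Rightarrow> real) \<Rightarrow> bool" where
  "dirichlet_solution a b f y v \<longleftrightarrow>
     has_weak_deriv a b y v \<and> has_weak_deriv a b v (\<lambda>x. - f x) \<and>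
     continuous_on {a..b} y \<and> y a = 0 \<and> y b = 0"

lemma has_weak_deriv_indefinite_integral:
  assumes "a < b" "f \<in> L2_space a b"
  shows "has_weak_deriv a b (\<lambda>x. C + integral {a..x} f) f"
    and "continuous_on {a..b} (\<lambda>x. C + integral {a..x} f)"
proof -
  have int: "integrable (lebesgue_on {a..b}) f"
    using assms(2) by (rule L2_space_integrable)
  then have "f integrable_on {a..b}"
    by (rule integrable_on_lebesgue_on) simp
  then show cont: "continuous_on {a..b} (\<lambda>x. C + integral {a..x} f)"
    by (intro continuous_intros indefinite_integral_continuous_1)
  have "L2_inner a b (\<lambda>x. C + integral {a..x} f) (deriv \<theta>) = - L2_inner a b f \<theta>"
    if \<theta>: "test_function a b \<theta>" for \<theta>
    unfolding L2_inner_def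
  proof (rule indefinite_integral_by_parts[OF _ int])
    show "continuous_on {a..b} (deriv \<theta>)"
      using test_function_continuous[OF \<theta>, of _ 1] by simp
    show "(\<theta> has_real_derivative deriv \<theta> x) (at x within {a..b})" for x
      using test_function_has_derivative[OF \<theta>, of 0 x]
      by (simp add: has_field_derivative_at_within)
    obtain c d where cd: "a < c" "d < b" "\<And>x. x \<notin> {c..d} \<Longrightarrow> \<theta> x = 0"
      using test_function_support[OF \<theta> assms(1)] by metis
    show "\<theta> a = 0" "\<theta> b = 0"
      by (rule cd(3); use cd(1,2) in simp)+
  qed (use assms in simp)
  then show "has_weak_deriv a b (\<lambda>x. C + integral {a..x} f) f"
    unfolding has_weak_deriv_def using assms(2) continuous_imp_L2_space[OF cont] by blast
qed

text \<open>
  Integrate twice; the constant \<open>c\<close> is minus the mean of the first integral, which makes the second one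
  vanish at \<open>b\<close>.
\<close>

lemma dirichlet_solution_exists:
  assumes "a < b" "f \<in> L2_space a b"
  obtains c where
    "dirichlet_solution a b f (\<lambda>x. integral {a..x} (\<lambda>s. c + integral {a..s} (\<lambda>t. - f t)))
      (\<lambda>x. c + integral {a..x} (\<lambda>t. - f t))"
proof -
  have mf: "(\<lambda>t. - f t) \<in> L2_space a b"
    using L2_space_scale[OF assms(2), of "-1"] by simp
  define F where "F x = integral {a..x} (\<lambda>t. - f t)" for x
  define c where "c = - integral {a..b} F / (b - a)"
  have v: "has_weak_deriv a b (\<lambda>x. c + F x) (\<lambda>t. - f t)" "continuous_on {a..b} (\<lambda>x. c + F x)"
    unfolding F_def using has_weak_deriv_indefinite_integral[OF assms(1) mf] by auto
  have "continuous_on {a..b} F"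
    unfolding F_def using has_weak_deriv_indefinite_integral(2)[OF assms(1) mf, of 0] by simp
  then have "integral {a..b} (\<lambda>x. c + F x) = integral {a..b} (\<lambda>x. c) + integral {a..b} F"
    by (intro Henstock_Kurzweil_Integration.integral_add integrable_continuous_real) auto
  also have "\<dots> = 0"
    using assms(1) by (simp add: c_def)
  finally have zero: "integral {a..b} (\<lambda>x. c + F x) = 0" .
  have "dirichlet_solution a b f (\<lambda>x. integral {a..x} (\<lambda>x. c + F x)) (\<lambda>x. c + F x)"
    unfolding dirichlet_solution_def
    using v zero has_weak_deriv_indefinite_integral[OF assms(1) continuous_imp_L2_space[OF v(2)], of 0]
    by simp
  then show thesis
    using that[of c] by (simp add: F_def)
qed

lemma dirichlet_solution_lincomb:
  assumes "dirichlet_solution a b f y v" "dirichlet_solution a b g z w"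
  shows "dirichlet_solution a b (\<lambda>x. c * f x + d * g x)
    (\<lambda>x. c * y x + d * z x) (\<lambda>x. c * v x + d * w x)"
proof -
  have "(\<lambda>x. - (c * f x + d * g x)) = (\<lambda>x. c * (- f x) + d * (- g x))"
    by simp
  then show ?thesis
    using assms has_weak_deriv_lincomb[of a b y v z w c d]
      has_weak_deriv_lincomb[of a b v "\<lambda>x. - f x" w "\<lambda>x. - g x" c d]
    unfolding dirichlet_solution_def
    by (simp add: continuous_on_add continuous_on_mult_left)
qed

lemma dirichlet_solution_L2_space:
  assumes "dirichlet_solution a b f y v"
  shows "y \<in> L2_space a b" "v \<in> L2_space a b"
  using assms by (simp_all add: dirichlet_solution_def has_weak_deriv_def)

text \<open>
  Two applications of the lemma of du Bois-Reymond show that \<open>v\<close> is constant and \<open>y\<close> affine; the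
  boundary values then leave only zero.
\<close>

lemma dirichlet_solution_0:
  assumes "a < b" "dirichlet_solution a b f y v" "L2_eq a b f (\<lambda>x. 0)"
  shows "\<And>x. x \<in> {a..b} \<Longrightarrow> y x = 0" "L2_eq a b v (\<lambda>x. 0)"
proof -
  have y: "has_weak_deriv a b y v" "continuous_on {a..b} y" "y a = 0" "y b = 0"
    and v: "has_weak_deriv a b v (\<lambda>x. - f x)"
    using assms(2) by (simp_all add: dirichlet_solution_def)
  have L2: "y \<in> L2_space a b" "v \<in> L2_space a b"
    using dirichlet_solution_L2_space[OF assms(2)] .
  have const: "(\<lambda>x. k) \<in> L2_space a b" for k
    by (intro continuous_imp_L2_space) simp
  have "L2_eq a b (\<lambda>x. - f x) (\<lambda>x. 0)"
    using assms(3) by (simp add: L2_eq_def)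
  from has_weak_deriv_cong[OF v L2_eq_refl L2(2) this const]
  obtain C where C: "L2_eq a b v (\<lambda>x. C)"
    using has_weak_deriv_0_imp_constant[OF assms(1)] by metis
  have yC: "has_weak_deriv a b y (\<lambda>x. C)"
    by (rule has_weak_deriv_cong[OF y(1) L2_eq_refl L2(1) C const])
  have lin: "has_weak_deriv a b (\<lambda>x. 0 + integral {a..x} (\<lambda>x. C)) (\<lambda>x. C)"
    by (rule has_weak_deriv_indefinite_integral[OF assms(1) const])
  have "has_weak_deriv a b (\<lambda>x. 1 * y x + (- 1) * (0 + integral {a..x} (\<lambda>x. C))) (\<lambda>x. 0)"
    using has_weak_deriv_lincomb[OF yC lin, of 1 "-1"] by simp
  then obtain D where
    D: "L2_eq a b (\<lambda>x. 1 * y x + (- 1) * (0 + integral {a..x} (\<lambda>x. C))) (\<lambda>x. D)"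
    using has_weak_deriv_0_imp_constant[OF assms(1)] by metis
  have eq: "y x = D + C * (x - a)" if "x \<in> {a..b}" for x
  proof (rule continuous_L2_eq_imp_eq[OF assms(1) y(2) _ _ that])
    have "AE x in lebesgue_on {a..b}. x \<in> {a..b}"
      by (intro AE_I2) simp
    with D show "L2_eq a b y (\<lambda>x. D + C * (x - a))"
      unfolding L2_eq_def by eventually_elim (auto simp: algebra_simps)
  qed (intro continuous_intros)
  have "D = 0" "C = 0"
    using eq[of a] eq[of b] y(3,4) assms(1) by auto
  then show "\<And>x. x \<in> {a..b} \<Longrightarrow> y x = 0" "L2_eq a b v (\<lambda>x. 0)"
    using eq C by simp_all
qed

lemma dirichlet_solution_unique:
  assumes "a < b" "dirichlet_solution a b f y v" "dirichlet_solution a b g z w" "L2_eq a b f g"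
  shows "\<And>x. x \<in> {a..b} \<Longrightarrow> y x = z x" "L2_eq a b v w"
proof -
  note diff = dirichlet_solution_0[OF assms(1) dirichlet_solution_lincomb[OF assms(2,3), of 1 "-1"]
      assms(4)[unfolded L2_eq_iff_diff[of a b f g]]]
  show "y x = z x" if "x \<in> {a..b}" for x
    using diff(1)[OF that] by simp
  show "L2_eq a b v w"
    using diff(2) unfolding L2_eq_iff_diff[of a b v w] .
qed

text \<open>
  This frees later arguments from the choice operators. Existence guarantees that the choice in
  \<open>neg_inv_laplacian\<close> is a solution in the sense of its defining condition, and uniqueness of weak
  derivatives identifies the chosen derivatives with any others.
\<close>

lemma dirichlet_solution_neg_inv_laplacian:
  assumes "a < b" "f \<in> L2_space a b"
  shows "dirichlet_solution a b f (neg_inv_laplacian a b f)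
    (weak_deriv a b (neg_inv_laplacian a b f))"
proof -
  define solves where "solves y \<longleftrightarrow> y \<in> H2_0_space a b \<and>
      L2_eq a b (\<lambda>x. - weak_deriv a b (weak_deriv a b y) x) f" for y
  have second: "has_weak_deriv a b (weak_deriv a b y) w \<and>
      has_weak_deriv a b (weak_deriv a b y) (weak_deriv a b (weak_deriv a b y)) \<and>
      L2_eq a b (weak_deriv a b (weak_deriv a b y)) w"
    if yv: "has_weak_deriv a b y v" and vw: "has_weak_deriv a b v w" for y v w
  proof -
    have y': "has_weak_deriv a b y (weak_deriv a b y)"
      using yv by (rule has_weak_deriv_weak_deriv)
    have "w \<in> L2_space a b" "weak_deriv a b y \<in> L2_space a b"
      using vw y' by (simp_all add: has_weak_deriv_def)
    then have w: "has_weak_deriv a b (weak_deriv a b y) w"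
      by (intro has_weak_deriv_cong[OF vw has_weak_deriv_unique[OF yv y']] L2_eq_refl)
    then show ?thesis
      using has_weak_deriv_weak_deriv[OF w] has_weak_deriv_unique[OF has_weak_deriv_weak_deriv[OF w] w]
      by simp
  qed
  have "\<exists>y. solves y"
  proof -
    obtain y v where sol: "dirichlet_solution a b f y v"
      using dirichlet_solution_exists[OF assms] by metis
    then have yv: "has_weak_deriv a b y v" "has_weak_deriv a b v (\<lambda>x. - f x)"
      by (simp_all add: dirichlet_solution_def)
    then have "y \<in> H2_0_space a b"
      using sol unfolding H2_0_space_def H2_space_def dirichlet_solution_def by blast
    moreover have "L2_eq a b (\<lambda>x. - weak_deriv a b (weak_deriv a b y) x) f"
      using second[OF yv] by (auto simp: L2_eq_def)
    ultimately show ?thesis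
      unfolding solves_def by blast
  qed
  then have "solves (neg_inv_laplacian a b f)"
    unfolding neg_inv_laplacian_def solves_def by (rule someI_ex)
  then obtain y where y: "y = neg_inv_laplacian a b f" "solves y"
    by simp
  then obtain v w where vw: "has_weak_deriv a b y v" "has_weak_deriv a b v w"
    unfolding solves_def H2_0_space_def H2_space_def by blast
  have neg: "L2_eq a b (weak_deriv a b (weak_deriv a b y)) (\<lambda>x. - f x)"
    using y(2) by (auto simp: solves_def L2_eq_def elim: eventually_mono)
  have y': "has_weak_deriv a b y (weak_deriv a b y)"
    using vw(1) by (rule has_weak_deriv_weak_deriv)
  then have "weak_deriv a b y \<in> L2_space a b"
    by (simp add: has_weak_deriv_def)
  moreover have "(\<lambda>x. - f x) \<in> L2_space a b"
    using L2_space_scale[OF assms(2), of "-1"] by simp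
  ultimately have "has_weak_deriv a b (weak_deriv a b y) (\<lambda>x. - f x)"
    using second[OF vw] by (intro has_weak_deriv_cong[OF _ L2_eq_refl _ neg]) auto
  then show ?thesis
    using y y' unfolding dirichlet_solution_def solves_def H2_0_space_def by simp
qed

text \<open>
  Green's identity, \<open>(y, -z'') = (y', z')\<close>. By uniqueness both solutions may be replaced by those
  obtained by integrating twice; then \<open>y\<close> is continuously differentiable and \<open>z'\<close> is an indefinite integral,
  which is the situation of integration by parts above.
\<close>

lemma dirichlet_solution_green:
  assumes "a < b" "f \<in> L2_space a b" "k \<in> L2_space a b"
    and "dirichlet_solution a b f y v" "dirichlet_solution a b k z w"
  shows "L2_inner a b y k = L2_inner a b v w"
proof -
  obtain c where c: "dirichlet_solution a b f
      (\<lambda>x. integral {a..x} (\<lambda>s. c + integral {a..s} (\<lambda>t. - f t)))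
      (\<lambda>x. c + integral {a..x} (\<lambda>t. - f t))"
    using dirichlet_solution_exists[OF assms(1,2)] .
  obtain d where d: "dirichlet_solution a b k
      (\<lambda>x. integral {a..x} (\<lambda>s. d + integral {a..s} (\<lambda>t. - k t)))
      (\<lambda>x. d + integral {a..x} (\<lambda>t. - k t))"
    using dirichlet_solution_exists[OF assms(1,3)] .
  define v0 where "v0 x = c + integral {a..x} (\<lambda>t. - f t)" for x
  define w0 where "w0 x = d + integral {a..x} (\<lambda>t. - k t)" for x
  define y0 where "y0 x = integral {a..x} v0" for x
  have v0: "dirichlet_solution a b f y0 v0"
    using c unfolding y0_def v0_def .
  have mf: "(\<lambda>t. - f t) \<in> L2_space a b" "(\<lambda>t. - k t) \<in> L2_space a b"
    using L2_space_scale[OF assms(2), of "-1"] L2_space_scale[OF assms(3), of "-1"] by simp_all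
  have cont: "continuous_on {a..b} v0"
    unfolding v0_def by (rule has_weak_deriv_indefinite_integral(2)[OF assms(1) mf(1)])
  have "L2_inner a b w0 v0 = - L2_inner a b (\<lambda>t. - k t) y0"
    unfolding L2_inner_def w0_def
  proof (rule indefinite_integral_by_parts)
    show "(y0 has_real_derivative v0 x) (at x within {a..b})" if "x \<in> {a..b}" for x
      unfolding y0_def using cont that by (rule integral_has_real_derivative)
    show "y0 a = 0" "y0 b = 0"
      using v0 by (simp_all add: dirichlet_solution_def)
  qed (use assms(1) cont L2_space_integrable[OF mf(2)] in auto)
  also have "\<dots> = L2_inner a b y0 k"
    by (simp add: L2_inner_def mult.commute)
  also have "\<dots> = L2_inner a b y k"
    using dirichlet_solution_unique(1)[OF assms(1) v0 assms(4) L2_eq_refl]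
      dirichlet_solution_L2_space(1)[OF v0] dirichlet_solution_L2_space(1)[OF assms(4)] assms(3)
    by (intro L2_inner_cong L2_eq_refl L2_eqI) auto
  finally have "L2_inner a b y k = L2_inner a b v0 w0"
    by (simp add: L2_inner_commute)
  also have "\<dots> = L2_inner a b v w"
    using dirichlet_solution_unique(2)[OF assms(1) v0 assms(4) L2_eq_refl]
      dirichlet_solution_unique(2)[OF assms(1) d[folded w0_def] assms(5) L2_eq_refl]
      dirichlet_solution_L2_space(2)[OF v0] dirichlet_solution_L2_space(2)[OF assms(4)]
      dirichlet_solution_L2_space(2)[OF d[folded w0_def]] dirichlet_solution_L2_space(2)[OF assms(5)]
    by (intro L2_inner_cong)
  finally show ?thesis .
qed

lemma neg_inv_laplacian_L2_space:
  assumes "a < b" "f \<in> L2_space a b"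
  shows "neg_inv_laplacian a b f \<in> L2_space a b"
    and "weak_deriv a b (neg_inv_laplacian a b f) \<in> L2_space a b"
  using dirichlet_solution_L2_space[OF dirichlet_solution_neg_inv_laplacian[OF assms]] .

lemma neg_inv_laplacian_lincomb:
  assumes "a < b" "f \<in> L2_space a b" "g \<in> L2_space a b" "h \<in> L2_space a b"
    and "L2_eq a b h (\<lambda>x. c * f x + d * g x)"
  shows "L2_eq a b (neg_inv_laplacian a b h)
      (\<lambda>x. c * neg_inv_laplacian a b f x + d * neg_inv_laplacian a b g x)"
    and "L2_eq a b (weak_deriv a b (neg_inv_laplacian a b h))
      (\<lambda>x. c * weak_deriv a b (neg_inv_laplacian a b f) x
         + d * weak_deriv a b (neg_inv_laplacian a b g) x)"
proof -
  note unique = dirichlet_solution_unique[OF assms(1)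
      dirichlet_solution_neg_inv_laplacian[OF assms(1,4)]
      dirichlet_solution_lincomb[OF dirichlet_solution_neg_inv_laplacian[OF assms(1,2)]
        dirichlet_solution_neg_inv_laplacian[OF assms(1,3)]] assms(5)]
  show "L2_eq a b (neg_inv_laplacian a b h)
      (\<lambda>x. c * neg_inv_laplacian a b f x + d * neg_inv_laplacian a b g x)"
    by (rule L2_eqI) (rule unique(1))
  show "L2_eq a b (weak_deriv a b (neg_inv_laplacian a b h))
      (\<lambda>x. c * weak_deriv a b (neg_inv_laplacian a b f) x
         + d * weak_deriv a b (neg_inv_laplacian a b g) x)"
    by (rule unique(2))
qed

section \<open>The bilinear form of the functional\<close>

text \<open>
  The bilinear form of the operator \<open>I - \<Delta>\<^sup>-\<^sup>1\<close>. Its quadratic form at the residual \<open>T \<psi> - g\<close> is the functional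
  of the theorem.
\<close>

definition misfit_form :: "real \<Rightarrow> real \<Rightarrow> (real \<Rightarrow> real) \<Rightarrow> (real \<Rightarrow> real) \<Rightarrow> real" where
  "misfit_form a b r s = L2_inner a b (\<lambda>x. r x + neg_inv_laplacian a b r x) s"

text \<open>
  By Green's identity the form is the inner product of \<open>L\<^sup>2\<close> plus a symmetric positive semidefinite form.
\<close>

lemma misfit_form_eq:
  assumes "a < b" "r \<in> L2_space a b" "s \<in> L2_space a b"
  shows "misfit_form a b r s = L2_inner a b r s
    + L2_inner a b (weak_deriv a b (neg_inv_laplacian a b r)) (weak_deriv a b (neg_inv_laplacian a b s))"
  using L2_inner_lincomb_left[OF assms(2) neg_inv_laplacian_L2_space(1)[OF assms(1,2)] assms(3), of 1 1]
    dirichlet_solution_green[OF assms dirichlet_solution_neg_inv_laplacian[OF assms(1,2)]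
      dirichlet_solution_neg_inv_laplacian[OF assms(1,3)]]
  by (simp add: misfit_form_def)

lemma misfit_form_commute:
  assumes "a < b" "r \<in> L2_space a b" "s \<in> L2_space a b"
  shows "misfit_form a b r s = misfit_form a b s r"
  using assms by (simp add: misfit_form_eq L2_inner_commute)

text \<open>
  Linearity is stated for any \<open>h\<close> that agrees almost everywhere with the combination, because the
  operators respect sums only up to equality almost everywhere. Compatibility with that equality is
  the case \<open>c = 1\<close>, \<open>d = 0\<close>.
\<close>

lemma misfit_form_lincomb_left:
  assumes "a < b" "f \<in> L2_space a b" "g \<in> L2_space a b" "h \<in> L2_space a b" "s \<in> L2_space a b"
    and "L2_eq a b h (\<lambda>x. c * f x + d * g x)"
  shows "misfit_form a b h s = c * misfit_form a b f s + d * misfit_form a b g s"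
proof -
  define S where "S r = (\<lambda>x. r x + neg_inv_laplacian a b r x)" for r
  have S: "S r \<in> L2_space a b" if "r \<in> L2_space a b" for r
    unfolding S_def using that neg_inv_laplacian_L2_space(1)[OF assms(1) that] by (rule L2_space_add)
  have "L2_eq a b (S h) (\<lambda>x. c * S f x + d * S g x)"
    using assms(6) neg_inv_laplacian_lincomb(1)[OF assms(1-4,6)]
    unfolding L2_eq_def S_def by eventually_elim (simp add: algebra_simps)
  then have "L2_inner a b (S h) s = L2_inner a b (\<lambda>x. c * S f x + d * S g x) s"
    using assms by (intro L2_inner_cong L2_eq_refl L2_space_lincomb S)
  also have "\<dots> = c * L2_inner a b (S f) s + d * L2_inner a b (S g) s"
    using assms by (intro L2_inner_lincomb_left S)
  finally show ?thesis
    by (simp add: misfit_form_def S_def)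
qed

lemma misfit_form_lincomb_right:
  assumes "a < b" "f \<in> L2_space a b" "g \<in> L2_space a b" "h \<in> L2_space a b" "s \<in> L2_space a b"
    and "L2_eq a b h (\<lambda>x. c * f x + d * g x)"
  shows "misfit_form a b s h = c * misfit_form a b s f + d * misfit_form a b s g"
  using misfit_form_lincomb_left[OF assms] misfit_form_commute[OF assms(1,5)] assms by simp

lemma misfit_form_pos:
  assumes "a < b" "r \<in> L2_space a b" "\<not> L2_eq a b r (\<lambda>x. 0)"
  shows "0 < misfit_form a b r r"
proof -
  have "0 \<le> L2_inner a b v v" for v
    by (simp add: L2_inner_def)
  then show ?thesis
    using L2_inner_self_pos[OF assms(2,3)] assms(1,2) by (simp add: misfit_form_eq add_pos_nonneg)
qed

section \<open>Differentials of quadratic functionals\<close>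

text \<open>
  Along lines a quadratic functional is a polynomial of degree two in \<open>\<epsilon>\<close>, and the differential is its
  linear coefficient.
\<close>

lemma has_gateauxI_quadratic:
  assumes "\<And>\<epsilon>. G (\<lambda>x. \<psi> x + \<epsilon> * h x) - G \<psi> = \<epsilon> * D + \<epsilon>\<^sup>2 * Q"
  shows "has_gateaux G \<psi> h D"
  unfolding has_gateaux_def
proof (rule Lim_transform_eventually)
  show "((\<lambda>\<epsilon>. D + \<epsilon> * Q) \<longlongrightarrow> D) (at 0)"
    by (auto intro!: tendsto_eq_intros)
  show "\<forall>\<^sub>F \<epsilon> in at 0. D + \<epsilon> * Q = (G (\<lambda>x. \<psi> x + \<epsilon> * h x) - G \<psi>) / \<epsilon>"
    unfolding assms by (auto simp: eventually_at_filter field_simps power2_eq_square)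
qed

lemma has_gateaux_unique: "has_gateaux G \<psi> h D \<Longrightarrow> has_gateaux G \<psi> h D' \<Longrightarrow> D = D'"
  unfolding has_gateaux_def by (rule tendsto_unique[OF trivial_limit_at])

lemma gateaux_eq: "has_gateaux G \<psi> h D \<Longrightarrow> gateaux G \<psi> h = D"
  unfolding gateaux_def by (rule the_equality, assumption, erule (1) has_gateaux_unique)

lemma gateaux2_eq: "has_gateaux2 G \<psi> h k D \<Longrightarrow> gateaux2 G \<psi> h k = D"
  unfolding gateaux2_def
  by (rule the_equality, assumption) (unfold has_gateaux2_def, elim conjE, erule (1) has_gateaux_unique)

lemma L2_bounded_linearD:
  assumes "L2_bounded_linear a b T"
  shows "\<forall>f\<in>L2_space a b. T f \<in> L2_space a b"
    and "\<forall>f\<in>L2_space a b. \<forall>g\<in>L2_space a b. L2_eq a b f g \<longrightarrow> L2_eq a b (T f) (T g)"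
    and "\<forall>f\<in>L2_space a b. \<forall>g\<in>L2_space a b.
        L2_eq a b (T (\<lambda>x. f x + g x)) (\<lambda>x. T f x + T g x)"
    and "\<forall>c. \<forall>f\<in>L2_space a b. L2_eq a b (T (\<lambda>x. c * f x)) (\<lambda>x. c * T f x)"
  using assms unfolding L2_bounded_linear_def by - (elim conjE, assumption)+

lemma L2_bounded_linear_lincomb:
  assumes "L2_bounded_linear a b T" "f \<in> L2_space a b" "g \<in> L2_space a b"
  shows "L2_eq a b (T (\<lambda>x. c * f x + d * g x)) (\<lambda>x. c * T f x + d * T g x)"
proof -
  note T = L2_bounded_linearD[OF assms(1), rule_format]
  note T(4)[OF assms(2), of c] T(4)[OF assms(3), of d]
    T(3)[OF L2_space_scale[OF assms(2), of c] L2_space_scale[OF assms(3), of d]]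
  then show ?thesis
    unfolding L2_eq_def by eventually_elim simp
qed

section \<open>The functional and its differentials\<close>

theorem theorem3p3:
  fixes a b :: real
    and T Tstar :: "(real \<Rightarrow> real) \<Rightarrow> (real \<Rightarrow> real)"
    and \<phi> g u :: "real \<Rightarrow> real"
    and U :: "(real \<Rightarrow> real) \<Rightarrow> (real \<Rightarrow> real)"
    and G :: "(real \<Rightarrow> real) \<Rightarrow> real"
  assumes "a < b"
    and "L2_bounded_linear a b T"
    and "L2_injective a b T"
    and "L2_adjoint a b T Tstar"
    and "\<phi> \<in> L2_space a b"
    and "g = T \<phi>"
    and "u = neg_inv_laplacian a b g"
    and "\<And>\<psi>. \<psi> \<in> L2_space a b \<Longrightarrow> U \<psi> = neg_inv_laplacian a b (T \<psi>)"
    and "\<And>\<psi>. \<psi> \<in> L2_space a b \<Longrightarrow>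
           G \<psi> = (L2_norm a b (\<lambda>x. T \<psi> x - g x))\<^sup>2
               + (L2_norm a b (\<lambda>x. weak_deriv a b u x - weak_deriv a b (U \<psi>) x))\<^sup>2"
  shows "(\<forall>\<psi>1\<in>L2_space a b. \<forall>\<psi>2\<in>L2_space a b.
            G \<psi>1 - G \<psi>2 =
              (LINT x|lebesgue_on {a..b}.
                 - 2 * T (\<lambda>t. \<psi>1 t - \<psi>2 t) x *
                   ((g x - (T \<psi>1 x + T \<psi>2 x) / 2) + (u x - (U \<psi>1 x + U \<psi>2 x) / 2))))
       \<and> (\<forall>\<psi>\<in>L2_space a b.
            (\<forall>h\<in>L2_space a b.
               has_gateaux G \<psi> h
                 (LINT x|lebesgue_on {a..b}.
                    T h x * (- 2 * ((g x - T \<psi> x) + (u x - U \<psi> x)))))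
            \<and> has_L2_gradient a b G \<psi>
                (\<lambda>x. - 2 * Tstar (\<lambda>t. (g t - T \<psi> t) + (u t - U \<psi> t)) x))
       \<and> (\<forall>\<psi>\<in>L2_space a b.
            (\<forall>h\<in>L2_space a b. \<forall>k\<in>L2_space a b.
               has_gateaux2 G \<psi> h k
                 (2 * L2_inner a b (\<lambda>x. T h x + neg_inv_laplacian a b (T h) x) (T k)))
            \<and> L2_pos_def_form a b (gateaux2 G \<psi>))"
proof -
  note ab = assms(1) and T = assms(2) and g = assms(6) and u = assms(7)
    and U = assms(8) and G = assms(9)
  define B where "B = misfit_form a b"
  \<comment> \<open>The residual \<open>r \<psi> = T \<psi> - g\<close>; the factors \<open>1\<close> and \<open>-1\<close> make it a linear combination
    of the shape that the lemmas on linearity expect.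
    The function \<open>e \<psi>\<close> equals \<open>(I - \<Delta>\<^sup>-\<^sup>1) (r \<psi>)\<close> almost everywhere.\<close>
  define r where "r \<psi> = (\<lambda>x. 1 * T \<psi> x + (- 1) * g x)" for \<psi>
  define e where "e \<psi> = (\<lambda>x. 1 * r \<psi> x + 1 * (1 * U \<psi> x + (- 1) * u x))" for \<psi>

  have T_L2: "T \<psi> \<in> L2_space a b" if "\<psi> \<in> L2_space a b" for \<psi>
    using L2_bounded_linearD(1)[OF T] that by (rule bspec)
  have g_L2: "g \<in> L2_space a b"
    using T_L2 assms(5) g by simp
  have r_L2: "r \<psi> \<in> L2_space a b" if "\<psi> \<in> L2_space a b" for \<psi>
    unfolding r_def by (intro L2_space_lincomb T_L2 g_L2 that)
  have u_L2: "u \<in> L2_space a b"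
    unfolding u by (rule neg_inv_laplacian_L2_space(1)[OF ab g_L2])
  have U_L2: "U \<psi> \<in> L2_space a b" if "\<psi> \<in> L2_space a b" for \<psi>
    unfolding U[OF that] by (rule neg_inv_laplacian_L2_space(1)[OF ab T_L2[OF that]])
  have e_L2: "e \<psi> \<in> L2_space a b" if "\<psi> \<in> L2_space a b" for \<psi>
    unfolding e_def by (intro L2_space_lincomb r_L2 U_L2 u_L2 that)
  have N_r: "L2_eq a b (neg_inv_laplacian a b (r \<psi>)) (\<lambda>x. 1 * U \<psi> x + (- 1) * u x)"
    "L2_eq a b (weak_deriv a b (neg_inv_laplacian a b (r \<psi>)))
       (\<lambda>x. 1 * weak_deriv a b (U \<psi>) x + (- 1) * weak_deriv a b u x)"
    if "\<psi> \<in> L2_space a b" for \<psi>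
  proof -
    have "L2_eq a b (r \<psi>) (\<lambda>x. 1 * T \<psi> x + (- 1) * g x)"
      unfolding r_def by (rule L2_eq_refl)
    note lincomb = neg_inv_laplacian_lincomb[OF ab T_L2[OF that] g_L2 r_L2[OF that] this]
    show "L2_eq a b (neg_inv_laplacian a b (r \<psi>)) (\<lambda>x. 1 * U \<psi> x + (- 1) * u x)"
      unfolding U[OF that] u by (rule lincomb(1))
    show "L2_eq a b (weak_deriv a b (neg_inv_laplacian a b (r \<psi>)))
       (\<lambda>x. 1 * weak_deriv a b (U \<psi>) x + (- 1) * weak_deriv a b u x)"
      unfolding U[OF that] u by (rule lincomb(2))
  qed

  have e_inner: "L2_inner a b (e \<psi>) k = B (r \<psi>) k"
    if "\<psi> \<in> L2_space a b" "k \<in> L2_space a b" for \<psi> k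
  proof -
    have "L2_eq a b (e \<psi>) (\<lambda>x. 1 * r \<psi> x + 1 * neg_inv_laplacian a b (r \<psi>) x)"
      unfolding e_def by (rule L2_eq_lincomb[OF L2_eq_refl L2_eq_sym[OF N_r(1)[OF that(1)]]])
    then have "L2_inner a b (e \<psi>) k
        = L2_inner a b (\<lambda>x. 1 * r \<psi> x + 1 * neg_inv_laplacian a b (r \<psi>) x) k"
      by (intro L2_inner_cong L2_eq_refl e_L2 L2_space_lincomb r_L2 that
          neg_inv_laplacian_L2_space(1)[OF ab])
    then show ?thesis
      by (simp add: B_def misfit_form_def)
  qed

  have G_eq: "G \<psi> = B (r \<psi>) (r \<psi>)" if \<psi>: "\<psi> \<in> L2_space a b" for \<psi>
  proof -
    define D where "D = (\<lambda>x. 1 * weak_deriv a b (U \<psi>) x + (- 1) * weak_deriv a b u x)"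
    have norm_sq: "(L2_norm a b f)\<^sup>2 = L2_inner a b f f" for f
      by (simp add: L2_norm_def L2_inner_def)
    have "(\<lambda>x. T \<psi> x - g x) = r \<psi>"
      by (simp add: r_def)
    moreover have "L2_inner a b (\<lambda>x. weak_deriv a b u x - weak_deriv a b (U \<psi>) x)
        (\<lambda>x. weak_deriv a b u x - weak_deriv a b (U \<psi>) x) = L2_inner a b D D"
      by (simp add: L2_inner_def D_def algebra_simps)
    ultimately have "G \<psi> = L2_inner a b (r \<psi>) (r \<psi>) + L2_inner a b D D"
      by (simp add: G[OF \<psi>] norm_sq)
    also have "L2_inner a b D D
        = L2_inner a b (weak_deriv a b (neg_inv_laplacian a b (r \<psi>)))
            (weak_deriv a b (neg_inv_laplacian a b (r \<psi>)))"
    proof (rule L2_inner_cong)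
      show "D \<in> L2_space a b" "D \<in> L2_space a b"
        unfolding D_def U[OF \<psi>] u
        by (intro L2_space_lincomb neg_inv_laplacian_L2_space(2)[OF ab] T_L2 \<psi> g_L2)+
      show "L2_eq a b D (weak_deriv a b (neg_inv_laplacian a b (r \<psi>)))"
        "L2_eq a b D (weak_deriv a b (neg_inv_laplacian a b (r \<psi>)))"
        unfolding D_def by (rule L2_eq_sym[OF N_r(2)[OF \<psi>]])+
    qed (intro neg_inv_laplacian_L2_space(2)[OF ab] r_L2 \<psi>)+
    finally show ?thesis
      unfolding B_def misfit_form_eq[OF ab r_L2[OF \<psi>] r_L2[OF \<psi>]] .
  qed

  have B_left: "B h s = c * B f s + d * B f' s"
    if "f \<in> L2_space a b" "f' \<in> L2_space a b" "h \<in> L2_space a b" "s \<in> L2_space a b"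
      "L2_eq a b h (\<lambda>x. c * f x + d * f' x)" for f f' h s c d
    unfolding B_def by (rule misfit_form_lincomb_left[OF ab that])
  have B_right: "B s h = c * B s f + d * B s f'"
    if "f \<in> L2_space a b" "f' \<in> L2_space a b" "h \<in> L2_space a b" "s \<in> L2_space a b"
      "L2_eq a b h (\<lambda>x. c * f x + d * f' x)" for f f' h s c d
    unfolding B_def by (rule misfit_form_lincomb_right[OF ab that])
  have B_commute: "B f s = B s f" if "f \<in> L2_space a b" "s \<in> L2_space a b" for f s
    unfolding B_def by (rule misfit_form_commute[OF ab that])

  have difference: "G \<psi>1 - G \<psi>2 =
      (LINT x|lebesgue_on {a..b}.
         - 2 * T (\<lambda>t. \<psi>1 t - \<psi>2 t) x *
           ((g x - (T \<psi>1 x + T \<psi>2 x) / 2) + (u x - (U \<psi>1 x + U \<psi>2 x) / 2)))"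
    if \<psi>: "\<psi>1 \<in> L2_space a b" "\<psi>2 \<in> L2_space a b" for \<psi>1 \<psi>2
  proof -
    define h where "h = T (\<lambda>t. \<psi>1 t - \<psi>2 t)"
    note r1 = r_L2[OF \<psi>(1)] and r2 = r_L2[OF \<psi>(2)]
    have h_L2: "h \<in> L2_space a b"
      unfolding h_def by (intro T_L2 L2_space_diff \<psi>)
    have "L2_eq a b h (\<lambda>x. 1 * T \<psi>1 x + (- 1) * T \<psi>2 x)"
      using L2_bounded_linear_lincomb[OF T \<psi>, of 1 "-1"] by (simp add: h_def)
    then have h: "L2_eq a b h (\<lambda>x. 1 * r \<psi>1 x + (- 1) * r \<psi>2 x)"
      by (simp add: r_def)
    have "(LINT x|lebesgue_on {a..b}.
         - 2 * T (\<lambda>t. \<psi>1 t - \<psi>2 t) x *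
           ((g x - (T \<psi>1 x + T \<psi>2 x) / 2) + (u x - (U \<psi>1 x + U \<psi>2 x) / 2)))
       = L2_inner a b (\<lambda>x. 1 * e \<psi>1 x + 1 * e \<psi>2 x) h"
      unfolding L2_inner_def h_def[symmetric]
      by (intro Bochner_Integration.integral_cong) (auto simp: e_def r_def field_simps)
    also have "\<dots> = B (r \<psi>1) h + B (r \<psi>2) h"
      unfolding L2_inner_lincomb_left[OF e_L2[OF \<psi>(1)] e_L2[OF \<psi>(2)] h_L2]
      by (simp add: e_inner \<psi> h_L2)
    \<comment> \<open>As \<open>h\<close> is \<open>r \<psi>1 - r \<psi>2\<close>, this is the difference of two squares for the symmetric form \<open>B\<close>.\<close>
    also have "\<dots> = B (r \<psi>1) (r \<psi>1) - B (r \<psi>2) (r \<psi>2)"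
      using B_right[OF r1 r2 h_L2 r1 h] B_right[OF r1 r2 h_L2 r2 h] B_commute[OF r1 r2] by simp
    finally show ?thesis
      by (simp add: G_eq \<psi>)
  qed

  have line_L2: "(\<lambda>x. \<psi> x + \<epsilon> * h x) \<in> L2_space a b"
    if "\<psi> \<in> L2_space a b" "h \<in> L2_space a b" for \<psi> h \<epsilon>
    using L2_space_lincomb[OF that, of 1 \<epsilon>] by simp
  have r_line: "L2_eq a b (r (\<lambda>x. \<psi> x + \<epsilon> * h x)) (\<lambda>x. 1 * r \<psi> x + \<epsilon> * T h x)"
    if "\<psi> \<in> L2_space a b" "h \<in> L2_space a b" for \<psi> h \<epsilon>
  proof -
    have "L2_eq a b (T (\<lambda>x. \<psi> x + \<epsilon> * h x)) (\<lambda>x. T \<psi> x + \<epsilon> * T h x)"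
      using L2_bounded_linear_lincomb[OF T that, of 1 \<epsilon>] by simp
    then show ?thesis
      unfolding L2_eq_def r_def by eventually_elim simp
  qed

  have first: "has_gateaux G \<psi> h (2 * B (r \<psi>) (T h))"
    if \<psi>: "\<psi> \<in> L2_space a b" and h: "h \<in> L2_space a b" for \<psi> h
  proof (rule has_gateauxI_quadratic[where Q = "B (T h) (T h)"])
    fix \<epsilon> :: real
    define \<eta> where "\<eta> = (\<lambda>x. \<psi> x + \<epsilon> * h x)"
    have \<eta>: "\<eta> \<in> L2_space a b" "L2_eq a b (r \<eta>) (\<lambda>x. 1 * r \<psi> x + \<epsilon> * T h x)"
      unfolding \<eta>_def using line_L2[OF \<psi> h] r_line[OF \<psi> h] by auto
    have "B (r \<eta>) (r \<eta>) = B (r \<psi>) (r \<eta>) + \<epsilon> * B (T h) (r \<eta>)"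
      using B_left[OF r_L2[OF \<psi>] T_L2[OF h] r_L2[OF \<eta>(1)] r_L2[OF \<eta>(1)] \<eta>(2)] by simp
    moreover have "B s (r \<eta>) = B s (r \<psi>) + \<epsilon> * B s (T h)" if "s \<in> L2_space a b" for s
      using B_right[OF r_L2[OF \<psi>] T_L2[OF h] r_L2[OF \<eta>(1)] that \<eta>(2)] by simp
    ultimately have "B (r \<eta>) (r \<eta>) - B (r \<psi>) (r \<psi>)
        = \<epsilon> * (2 * B (r \<psi>) (T h)) + \<epsilon>\<^sup>2 * B (T h) (T h)"
      using B_commute[OF r_L2[OF \<psi>] T_L2[OF h]] r_L2[OF \<psi>] T_L2[OF h]
      by (simp add: algebra_simps power2_eq_square)
    then show "G (\<lambda>x. \<psi> x + \<epsilon> * h x) - G \<psi>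
        = \<epsilon> * (2 * B (r \<psi>) (T h)) + \<epsilon>\<^sup>2 * B (T h) (T h)"
      by (simp add: G_eq \<psi> \<eta>(1) \<eta>_def[symmetric])
  qed
  have first_value: "2 * B (r \<psi>) (T h)
      = (LINT x|lebesgue_on {a..b}. T h x * (- 2 * ((g x - T \<psi> x) + (u x - U \<psi> x))))"
    if "\<psi> \<in> L2_space a b" "h \<in> L2_space a b" for \<psi> h
  proof -
    have "2 * B (r \<psi>) (T h) = (LINT x|lebesgue_on {a..b}. 2 * (e \<psi> x * T h x))"
      using e_inner[OF that(1) T_L2[OF that(2)]] by (simp add: L2_inner_def)
    also have "\<dots> = (LINT x|lebesgue_on {a..b}. T h x * (- 2 * ((g x - T \<psi> x) + (u x - U \<psi> x))))"
      by (intro Bochner_Integration.integral_cong) (auto simp: e_def r_def algebra_simps)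
    finally show ?thesis .
  qed

  have gradient: "has_L2_gradient a b G \<psi> (\<lambda>x. - 2 * Tstar (\<lambda>t. (g t - T \<psi> t) + (u t - U \<psi> t)) x)"
    if \<psi>: "\<psi> \<in> L2_space a b" for \<psi>
    unfolding has_L2_gradient_def
  proof (intro conjI ballI)
    define q where "q = (\<lambda>t. (g t - T \<psi> t) + (u t - U \<psi> t))"
    have q_L2: "q \<in> L2_space a b"
      unfolding q_def by (intro L2_space_add L2_space_diff g_L2 T_L2 u_L2 U_L2 \<psi>)
    have adjoint: "\<forall>f\<in>L2_space a b. Tstar f \<in> L2_space a b"
      "\<forall>f\<in>L2_space a b. \<forall>s\<in>L2_space a b. L2_inner a b (T f) s = L2_inner a b f (Tstar s)"
      using assms(4) unfolding L2_adjoint_def by - (elim conjE, assumption)+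
    have "Tstar q \<in> L2_space a b"
      using adjoint(1) q_L2 by (rule bspec)
    then show "(\<lambda>x. - 2 * Tstar (\<lambda>t. (g t - T \<psi> t) + (u t - U \<psi> t)) x) \<in> L2_space a b"
      unfolding q_def by (rule L2_space_scale)
    fix h assume h: "h \<in> L2_space a b"
    have scale: "L2_inner a b f (\<lambda>x. - 2 * s x) = - 2 * L2_inner a b f s" for f s
      unfolding L2_inner_def mult.left_commute[of _ "- 2"] by (rule integral_mult_right_zero)
    have "L2_inner a b (T h) q = L2_inner a b h (Tstar q)"
      by (rule adjoint(2)[rule_format, OF h q_L2])
    then have "L2_inner a b h (\<lambda>x. - 2 * Tstar q x) = L2_inner a b (T h) (\<lambda>x. - 2 * q x)"
      by (simp only: scale)
    also have "\<dots> = 2 * B (r \<psi>) (T h)"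
      unfolding first_value[OF \<psi> h] by (simp only: L2_inner_def q_def)
    finally show "has_gateaux G \<psi> h
        (L2_inner a b h (\<lambda>x. - 2 * Tstar (\<lambda>t. (g t - T \<psi> t) + (u t - U \<psi> t)) x))"
      using first[OF \<psi> h] by (simp only: q_def)
  qed

  have second: "has_gateaux2 G \<psi> h k (2 * B (T h) (T k))"
    if \<psi>: "\<psi> \<in> L2_space a b" and h: "h \<in> L2_space a b" and k: "k \<in> L2_space a b" for \<psi> h k
    unfolding has_gateaux2_def
  proof (intro conjI always_eventually allI)
    show "\<exists>D. has_gateaux G (\<lambda>x. \<psi> x + \<epsilon> * h x) k D" for \<epsilon>
      using first[OF line_L2[OF \<psi> h] k] by blast
    show "has_gateaux (\<lambda>\<eta>. gateaux G \<eta> k) \<psi> h (2 * B (T h) (T k))"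
    \<comment> \<open>The first differential is affine along lines, so its quadratic coefficient is zero.\<close>
    proof (rule has_gateauxI_quadratic[where Q = 0])
      fix \<epsilon> :: real
      have "B (r (\<lambda>x. \<psi> x + \<epsilon> * h x)) (T k) = 1 * B (r \<psi>) (T k) + \<epsilon> * B (T h) (T k)"
        by (rule B_left[OF r_L2[OF \<psi>] T_L2[OF h] r_L2[OF line_L2[OF \<psi> h]] T_L2[OF k]
              r_line[OF \<psi> h]])
      then show "gateaux G (\<lambda>x. \<psi> x + \<epsilon> * h x) k - gateaux G \<psi> k
          = \<epsilon> * (2 * B (T h) (T k)) + \<epsilon>\<^sup>2 * 0"
        unfolding gateaux_eq[OF first[OF \<psi> k]] gateaux_eq[OF first[OF line_L2[OF \<psi> h] k]]
        by (simp add: algebra_simps)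
    qed
  qed

  have positive: "L2_pos_def_form a b (gateaux2 G \<psi>)" if \<psi>: "\<psi> \<in> L2_space a b" for \<psi>
  proof -
    note form_eq = gateaux2_eq[OF second[OF \<psi>]]
    have "gateaux2 G \<psi> h k = gateaux2 G \<psi> h' k"
      if "h \<in> L2_space a b" "h' \<in> L2_space a b" "k \<in> L2_space a b" "L2_eq a b h h'" for h h' k
    proof -
      have "L2_eq a b (T h) (T h')"
        by (rule L2_bounded_linearD(2)[OF T, rule_format, OF that(1,2,4)])
      then have "L2_eq a b (T h) (\<lambda>x. 1 * T h' x + 0 * T h' x)"
        by simp
      from B_left[OF T_L2[OF that(2)] T_L2[OF that(2)] T_L2[OF that(1)] T_L2[OF that(3)] this]
      show ?thesis by (simp add: form_eq that)
    qed
    moreover have "gateaux2 G \<psi> h k = gateaux2 G \<psi> k h"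
      if "h \<in> L2_space a b" "k \<in> L2_space a b" for h k
      using B_commute[OF T_L2[OF that(1)] T_L2[OF that(2)]] by (simp add: form_eq that)
    moreover have "gateaux2 G \<psi> (\<lambda>x. h x + h' x) k = gateaux2 G \<psi> h k + gateaux2 G \<psi> h' k"
      if "h \<in> L2_space a b" "h' \<in> L2_space a b" "k \<in> L2_space a b" for h h' k
    proof -
      have "L2_eq a b (T (\<lambda>x. h x + h' x)) (\<lambda>x. 1 * T h x + 1 * T h' x)"
        using L2_bounded_linear_lincomb[OF T that(1,2), of 1 1] by simp
      from B_left[OF T_L2[OF that(1)] T_L2[OF that(2)] T_L2[OF L2_space_add[OF that(1,2)]]
          T_L2[OF that(3)] this]
      show ?thesis by (simp add: form_eq that L2_space_add)
    qed
    moreover have scale: "gateaux2 G \<psi> (\<lambda>x. c * h x) k = c * gateaux2 G \<psi> h k"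
      if "h \<in> L2_space a b" "k \<in> L2_space a b" for c h k
    proof -
      have "L2_eq a b (T (\<lambda>x. c * h x)) (\<lambda>x. c * T h x + 0 * T h x)"
        using L2_bounded_linear_lincomb[OF T that(1,1), of c 0] by simp
      from B_left[OF T_L2[OF that(1)] T_L2[OF that(1)] T_L2[OF L2_space_scale[OF that(1)]]
          T_L2[OF that(2)] this]
      show ?thesis by (simp add: form_eq that L2_space_scale)
    qed
    moreover have "gateaux2 G \<psi> h h > 0"
      if h: "h \<in> L2_space a b" and ne: "\<not> L2_eq a b h (\<lambda>x. 0)" for h
    proof -
      have zero: "(\<lambda>x. 0) \<in> L2_space a b"
        using L2_space_scale[OF h, of 0] by simp
      have "L2_eq a b (T (\<lambda>x. 0)) (\<lambda>x. 0)"
        using L2_bounded_linear_lincomb[OF T h h, of 0 0] by simp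
      then have T0: "L2_eq a b (\<lambda>x. 0) (T (\<lambda>x. 0))"
        by (rule L2_eq_sym)
      have "\<not> L2_eq a b (T h) (\<lambda>x. 0)"
      proof
        assume "L2_eq a b (T h) (\<lambda>x. 0)"
        then have "L2_eq a b (T h) (T (\<lambda>x. 0))"
          using T0 by (rule L2_eq_trans)
        then have "L2_eq a b h (\<lambda>x. 0)"
          using assms(3)[unfolded L2_injective_def, rule_format, OF h zero] by simp
        with ne show False ..
      qed
      from misfit_form_pos[OF ab T_L2[OF h] this] show ?thesis
        by (simp add: form_eq h B_def)
    qed
    ultimately show ?thesis
      unfolding L2_pos_def_form_def by blast
  qed

  show ?thesis
  proof (intro conjI ballI)
    fix \<psi> h assume "\<psi> \<in> L2_space a b" "h \<in> L2_space a b"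
    then show "has_gateaux G \<psi> h
        (LINT x|lebesgue_on {a..b}. T h x * (- 2 * ((g x - T \<psi> x) + (u x - U \<psi> x))))"
      using first first_value by simp
  next
    fix \<psi> h k assume "\<psi> \<in> L2_space a b" "h \<in> L2_space a b" "k \<in> L2_space a b"
    then show "has_gateaux2 G \<psi> h k
        (2 * L2_inner a b (\<lambda>x. T h x + neg_inv_laplacian a b (T h) x) (T k))"
      using second by (simp only: B_def misfit_form_def)
  qed (fact difference gradient positive)+
qed

end
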